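(* Let $Q$ be a (finite) separated single-arrow quiver. (a) If $T,\widetilde T\in \mathrm{Rep}_{os}(Q,\mathcal H)$ are orthoscalar representations with the same character and $T$ is equivalent to $\widetilde T$ in $\mathrm{Rep}(Q)$, then $T$ is equivalent to $\widetilde T$ in $\mathrm{Rep}_{os}(Q,\mathcal H)$. (b) If $T$ is an indecomposable representation in $\mathrm{Rep}_{os}(Q,\mathcal H)$, then $T$ is indecomposable, and moreover Schurian (a brick), in $\mathrm{Rep}(Q)$.
   Context: A quiver $Q$ with finite vertex set $Q_v$ and finite arrow set $Q_a$ (an arrow $\alpha$ has tail $t_\alpha$ and head $h_\alpha$) is separated if $Q_v=\overset{\circ}{Q}\sqcup\overset{\bullet}{Q}$ and every arrow $\alpha$ has $t_\alpha\in\overset{\circ}{Q}$ and $h_\alpha\in\overset{\bullet}{Q}$. It is single-arrow if for distinct arrows $\alpha\ne\beta$ either $t_\alpha\neq t_\beta$ or $h_\alpha\ne h_\beta$. $\mathrm{Rep}(Q)$ is the category of finite-dimensional complex representations: $T$ assigns to each vertex $i$ a finite-dimensional complex vector space $T(i)$ and to each arrow $j\to i$ a linear map $T_{ij}:T(j)\to T(i)$ (put $T_{ij}=0$ if there is no arrow $j\to i$). A morphism $C:T\to\widetilde T$ is a family of linear maps $C_i:T(i)\to\widetilde T(i)$, $i\in Q_v$, with $C_iT_{ij}=\widetilde T_{ij}C_j$ for every arrow $j\to i$. $\mathrm{Rep}(Q,\mathcal H)$ is the (non-full) subcategory whose objects are representations with every $T(i)$ a finite-dimensional complex Hilbert space,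 and whose morphisms are the morphisms $C$ of $\mathrm{Rep}(Q)$ that in addition satisfy $C_jT_{ij}^*=\widetilde T_{ij}^*C_i$ for every arrow $j\to i$. A representation $T$ in $\mathrm{Rep}(Q,\mathcal H)$ is orthoscalar with character $\chi=(\chi_i)_{i\in Q_v}$, $\chi_i\ge 0$ real, if $\sum_{j\in\overset{\circ}{Q}}T_{ij}T_{ij}^*=\chi_i I_{T(i)}$ for every $i\in\overset{\bullet}{Q}$ and $\sum_{i\in\overset{\bullet}{Q}}T_{ij}^*T_{ij}=\chi_jI_{T(j)}$ for every $j\in\overset{\circ}{Q}$. (The value $\chi_i$ is uniquely determined by $T$ when $T(i)\ne0$ and is arbitrary when $T(i)=0$.) $\mathrm{Rep}_{os}(Q,\mathcal H)$ is the full subcategory of $\mathrm{Rep}(Q,\mathcal H)$ of orthoscalar representations. Two representations are equivalent in one of these categories if there is an invertible morphism between them in that category (in $\mathrm{Rep}(Q,\mathcal H)$ and $\mathrm{Rep}_{os}(Q,\mathcal H)$ this is the same as unitary equivalence). A nonzero representation is indecomposable in a category if it is not isomorphic there to a direct sum of two nonzero representations (orthogonal direct sum in the Hilbert space categories). A representation is Schurian (a brick) in a category if its endomorphism ring there is isomorphic to $\mathbb C$. *)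

theory Defs
  imports
    Complex_Main
    "HOL-Library.FuncSet"
    "HOL-Library.Product_Plus"
    "HOL-Algebra.QuotRing"
    "HOL-Algebra.Algebraic_Closure_Type"
    "Graph_Theory.Digraph"
begin

section \<open>Quivers\<close>

text \<open>
  A quiver is a \<^typ>\<open>('v, 'e) pre_digraph\<close>; finiteness is \<^const>\<open>fin_digraph\<close>, and being
  single-arrow is exactly \<^const>\<open>nomulti_digraph\<close>. In a separated quiver \<open>W\<close> is the set of
  white vertices (the tails) and \<open>B\<close> the set of black vertices (the heads); isolated vertices may
  be of either colour.
\<close>

definition separated :: "('v, 'e) pre_digraph \<Rightarrow> 'v set \<Rightarrow> 'v set \<Rightarrow> bool" where
  "separated Q W B \<longleftrightarrow>
     verts Q = W \<union> B \<and> W \<inter> B = {} \<and> (\<forall>\<alpha>\<in>arcs Q. tail Q \<alpha> \<in> W \<and> head Q \<alpha> \<in> B)"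

section \<open>Representations in vector spaces\<close>

text \<open>
  The spaces of one representation are finite-dimensional subspaces of an ambient complex vector
  space (the type \<open>'a\<close> with scalar multiplication \<open>scl\<close>), which may differ from
  representation to representation. This is no restriction, as a family of spaces
  embeds in its direct sum; the spaces at distinct vertices are otherwise unrelated and may overlap.
  The values of \<open>amap T \<alpha>\<close> outside the space at the tail of \<open>\<alpha>\<close> are irrelevant.
\<close>

record ('v, 'e, 'a) rep =
  scl :: "complex \<Rightarrow> 'a \<Rightarrow> 'a"
  vspace :: "'v \<Rightarrow> 'a set"
  amap :: "'e \<Rightarrow> 'a \<Rightarrow> 'a"

definition findim_subspace ::
  "(complex \<Rightarrow> 'a \<Rightarrow> 'a::ab_group_add) \<Rightarrow> 'a set \<Rightarrow> bool" where
  "findim_subspace s V \<longleftrightarrow> module.subspace s V \<and> (\<exists>A. finite A \<and> V = module.span s A)"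

definition linear_between ::
  "(complex \<Rightarrow> 'a \<Rightarrow> 'a::ab_group_add) \<Rightarrow> 'a set \<Rightarrow>
   (complex \<Rightarrow> 'b \<Rightarrow> 'b::ab_group_add) \<Rightarrow> 'b set \<Rightarrow> ('a \<Rightarrow> 'b) \<Rightarrow> bool" where
  "linear_between s V s' V' f \<longleftrightarrow>
     (\<forall>x\<in>V. f x \<in> V') \<and>
     (\<forall>x\<in>V. \<forall>y\<in>V. f (x + y) = f x + f y) \<and>
     (\<forall>c. \<forall>x\<in>V. f (s c x) = s' c (f x))"

definition is_rep ::
  "('v, 'e) pre_digraph \<Rightarrow> ('v, 'e, 'a::ab_group_add, 'm) rep_scheme \<Rightarrow> bool" where
  "is_rep Q T \<longleftrightarrow>
     vector_space (scl T) \<and>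
     (\<forall>i\<in>verts Q. findim_subspace (scl T) (vspace T i)) \<and>
     (\<forall>\<alpha>\<in>arcs Q. linear_between (scl T) (vspace T (tail Q \<alpha>))
                                 (scl T) (vspace T (head Q \<alpha>)) (amap T \<alpha>))"

definition nonzero_rep ::
  "('v, 'e) pre_digraph \<Rightarrow> ('v, 'e, 'a::ab_group_add, 'm) rep_scheme \<Rightarrow> bool" where
  "nonzero_rep Q T \<longleftrightarrow> (\<exists>i\<in>verts Q. vspace T i \<noteq> {0})"

text \<open>
  Morphisms are made extensional (\<^const>\<open>undefined\<close> outside the vertices and
  outside the spaces), so that equality of morphisms is equality of functions.
\<close>

definition RepHom ::
  "('v, 'e) pre_digraph \<Rightarrow> ('v, 'e, 'a::ab_group_add, 'm) rep_scheme \<Rightarrow>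
   ('v, 'e, 'b::ab_group_add, 'n) rep_scheme \<Rightarrow> ('v \<Rightarrow> 'a \<Rightarrow> 'b) set" where
  "RepHom Q T U =
     {C \<in> extensional (verts Q).
        (\<forall>i\<in>verts Q. C i \<in> extensional (vspace T i) \<and>
                      linear_between (scl T) (vspace T i) (scl U) (vspace U i) (C i)) \<and>
        (\<forall>\<alpha>\<in>arcs Q. \<forall>x\<in>vspace T (tail Q \<alpha>).
           C (head Q \<alpha>) (amap T \<alpha> x) = amap U \<alpha> (C (tail Q \<alpha>) x))}"

definition id_mor ::
  "('v, 'e) pre_digraph \<Rightarrow> ('v, 'e, 'a, 'm) rep_scheme \<Rightarrow> 'v \<Rightarrow> 'a \<Rightarrow> 'a" where
  "id_mor Q T = (\<lambda>i\<in>verts Q. \<lambda>x\<in>vspace T i. x)"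

text \<open>\<open>comp_mor Q T D C\<close> is the composite \<open>D \<circ> C\<close>, where \<open>T\<close> is the domain of \<open>C\<close>.\<close>

definition comp_mor ::
  "('v, 'e) pre_digraph \<Rightarrow> ('v, 'e, 'a, 'm) rep_scheme \<Rightarrow>
   ('v \<Rightarrow> 'b \<Rightarrow> 'c) \<Rightarrow> ('v \<Rightarrow> 'a \<Rightarrow> 'b) \<Rightarrow> 'v \<Rightarrow> 'a \<Rightarrow> 'c" where
  "comp_mor Q T D C = (\<lambda>i\<in>verts Q. \<lambda>x\<in>vspace T i. D i (C i x))"

definition rep_equiv ::
  "('v, 'e) pre_digraph \<Rightarrow> ('v, 'e, 'a::ab_group_add, 'm) rep_scheme \<Rightarrow>
   ('v, 'e, 'b::ab_group_add, 'n) rep_scheme \<Rightarrow> bool" where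
  "rep_equiv Q T U \<longleftrightarrow>
     is_rep Q T \<and> is_rep Q U \<and>
     (\<exists>C\<in>RepHom Q T U. \<exists>D\<in>RepHom Q U T.
        comp_mor Q T D C = id_mor Q T \<and> comp_mor Q U C D = id_mor Q U)"

definition rep_dsum ::
  "('v, 'e, 'a, 'm) rep_scheme \<Rightarrow> ('v, 'e, 'b, 'n) rep_scheme \<Rightarrow> ('v, 'e, 'a \<times> 'b) rep" where
  "rep_dsum U V =
     \<lparr> scl = (\<lambda>c (x, y). (scl U c x, scl V c y)),
       vspace = (\<lambda>i. vspace U i \<times> vspace V i),
       amap = (\<lambda>\<alpha> (x, y). (amap U \<alpha> x, amap V \<alpha> y)) \<rparr>"

text \<open>
  The summands may be taken over the type \<open>'a\<close> of \<open>T\<close> without loss of generality, since a direct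
  summand is isomorphic to a subrepresentation of \<open>T\<close>.
\<close>

definition indecomposable_Rep ::
  "('v, 'e) pre_digraph \<Rightarrow> ('v, 'e, 'a::ab_group_add, 'm) rep_scheme \<Rightarrow> bool" where
  "indecomposable_Rep Q T \<longleftrightarrow>
     is_rep Q T \<and> nonzero_rep Q T \<and>
     \<not> (\<exists>(U :: ('v, 'e, 'a) rep) (V :: ('v, 'e, 'a) rep).
          is_rep Q U \<and> is_rep Q V \<and> nonzero_rep Q U \<and> nonzero_rep Q V \<and>
          rep_equiv Q T (rep_dsum U V))"

definition End_ring ::
  "('v, 'e) pre_digraph \<Rightarrow> ('v, 'e, 'a::ab_group_add, 'm) rep_scheme \<Rightarrow> ('v \<Rightarrow> 'a \<Rightarrow> 'a) ring" where
  "End_ring Q T =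
     \<lparr> carrier = RepHom Q T T,
       monoid.mult = comp_mor Q T,
       one = id_mor Q T,
       zero = (\<lambda>i\<in>verts Q. \<lambda>x\<in>vspace T i. 0),
       add = (\<lambda>C D. \<lambda>i\<in>verts Q. \<lambda>x\<in>vspace T i. C i x + D i x) \<rparr>"

definition schurian_Rep ::
  "('v, 'e) pre_digraph \<Rightarrow> ('v, 'e, 'a::ab_group_add, 'm) rep_scheme \<Rightarrow> bool" where
  "schurian_Rep Q T \<longleftrightarrow>
     is_rep Q T \<and> is_ring_iso (End_ring Q T) (ring_of_type_algebra :: complex ring)"

section \<open>Representations in Hilbert spaces\<close>

text \<open>
  The inner product \<open>ip T i\<close> on the space at \<open>i\<close> is linear in the first argument. Completeness
  is automatic in finite dimension.
\<close>

record ('v, 'e, 'a) hrep = "('v, 'e, 'a) rep" +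
  ip :: "'v \<Rightarrow> 'a \<Rightarrow> 'a \<Rightarrow> complex"

definition inner_product_on ::
  "(complex \<Rightarrow> 'a \<Rightarrow> 'a::ab_group_add) \<Rightarrow> 'a set \<Rightarrow> ('a \<Rightarrow> 'a \<Rightarrow> complex) \<Rightarrow> bool" where
  "inner_product_on s V f \<longleftrightarrow>
     (\<forall>x\<in>V. \<forall>y\<in>V. \<forall>z\<in>V. f (x + y) z = f x z + f y z) \<and>
     (\<forall>c. \<forall>x\<in>V. \<forall>y\<in>V. f (s c x) y = c * f x y) \<and>
     (\<forall>x\<in>V. \<forall>y\<in>V. f y x = cnj (f x y)) \<and>
     (\<forall>x\<in>V. x \<noteq> 0 \<longrightarrow> f x x \<in> \<real> \<and> 0 < Re (f x x))"

definition is_hrep ::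
  "('v, 'e) pre_digraph \<Rightarrow> ('v, 'e, 'a::ab_group_add) hrep \<Rightarrow> bool" where
  "is_hrep Q T \<longleftrightarrow>
     is_rep Q T \<and> (\<forall>i\<in>verts Q. inner_product_on (scl T) (vspace T i) (ip T i))"

text \<open>
  The adjoint of \<open>amap T \<alpha>\<close>, from the space at the head of \<open>\<alpha>\<close> to the space at its tail; by the
  Riesz representation theorem the description is well-defined on the space at the head.
\<close>

definition adj ::
  "('v, 'e) pre_digraph \<Rightarrow> ('v, 'e, 'a) hrep \<Rightarrow> 'e \<Rightarrow> 'a \<Rightarrow> 'a" where
  "adj Q T \<alpha> y =
     (THE x. x \<in> vspace T (tail Q \<alpha>) \<and>
        (\<forall>v\<in>vspace T (tail Q \<alpha>). ip T (head Q \<alpha>) (amap T \<alpha> v) y = ip T (tail Q \<alpha>) v x))"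

definition HRepHom ::
  "('v, 'e) pre_digraph \<Rightarrow> ('v, 'e, 'a::ab_group_add) hrep \<Rightarrow>
   ('v, 'e, 'b::ab_group_add) hrep \<Rightarrow> ('v \<Rightarrow> 'a \<Rightarrow> 'b) set" where
  "HRepHom Q T U =
     {C \<in> RepHom Q T U. \<forall>\<alpha>\<in>arcs Q. \<forall>y\<in>vspace T (head Q \<alpha>).
        C (tail Q \<alpha>) (adj Q T \<alpha> y) = adj Q U \<alpha> (C (head Q \<alpha>) y)}"

definition hrep_dsum ::
  "('v, 'e, 'a) hrep \<Rightarrow> ('v, 'e, 'b) hrep \<Rightarrow> ('v, 'e, 'a \<times> 'b) hrep" where
  "hrep_dsum U V =
     rep.extend (rep_dsum U V)
       (hrep.fields (\<lambda>i (x, y) (x', y'). ip U i x x' + ip V i y y'))"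

section \<open>Orthoscalar representations\<close>

text \<open>
  For a single-arrow quiver the sum of \<open>T\<^sub>i\<^sub>j T\<^sub>i\<^sub>j\<^sup>*\<close> over all white \<open>j\<close>, with \<open>T\<^sub>i\<^sub>j = 0\<close> if there
  is no arrow from \<open>j\<close> to \<open>i\<close>, is the sum over the arrows with head \<open>i\<close>; dually for the other
  condition.
\<close>

definition orthoscalar ::
  "('v, 'e) pre_digraph \<Rightarrow> 'v set \<Rightarrow> 'v set \<Rightarrow> ('v \<Rightarrow> real) \<Rightarrow>
   ('v, 'e, 'a::ab_group_add) hrep \<Rightarrow> bool" where
  "orthoscalar Q W B \<chi> T \<longleftrightarrow>
     is_hrep Q T \<and> (\<forall>i\<in>verts Q. 0 \<le> \<chi> i) \<and>
     (\<forall>i\<in>B. \<forall>x\<in>vspace T i.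
        (\<Sum>\<alpha>\<in>in_arcs Q i. amap T \<alpha> (adj Q T \<alpha> x)) = scl T (of_real (\<chi> i)) x) \<and>
     (\<forall>j\<in>W. \<forall>x\<in>vspace T j.
        (\<Sum>\<alpha>\<in>out_arcs Q j. adj Q T \<alpha> (amap T \<alpha> x)) = scl T (of_real (\<chi> j)) x)"

definition is_osrep ::
  "('v, 'e) pre_digraph \<Rightarrow> 'v set \<Rightarrow> 'v set \<Rightarrow> ('v, 'e, 'a::ab_group_add) hrep \<Rightarrow> bool" where
  "is_osrep Q W B T \<longleftrightarrow> (\<exists>\<chi>. orthoscalar Q W B \<chi> T)"

definition osrep_equiv ::
  "('v, 'e) pre_digraph \<Rightarrow> 'v set \<Rightarrow> 'v set \<Rightarrow> ('v, 'e, 'a::ab_group_add) hrep \<Rightarrow>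
   ('v, 'e, 'b::ab_group_add) hrep \<Rightarrow> bool" where
  "osrep_equiv Q W B T U \<longleftrightarrow>
     is_osrep Q W B T \<and> is_osrep Q W B U \<and>
     (\<exists>C\<in>HRepHom Q T U. \<exists>D\<in>HRepHom Q U T.
        comp_mor Q T D C = id_mor Q T \<and> comp_mor Q U C D = id_mor Q U)"

definition indecomposable_Rep_os ::
  "('v, 'e) pre_digraph \<Rightarrow> 'v set \<Rightarrow> 'v set \<Rightarrow> ('v, 'e, 'a::ab_group_add) hrep \<Rightarrow> bool" where
  "indecomposable_Rep_os Q W B T \<longleftrightarrow>
     is_osrep Q W B T \<and> nonzero_rep Q T \<and>
     \<not> (\<exists>(U :: ('v, 'e, 'a) hrep) (V :: ('v, 'e, 'a) hrep).
          is_osrep Q W B U \<and> is_osrep Q W B V \<and> nonzero_rep Q U \<and> nonzero_rep Q V \<and>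
          osrep_equiv Q W B T (hrep_dsum U V))"

end

theory Submission
  imports Defs "HOL-Computational_Algebra.Fundamental_Theorem_Algebra"
begin

text \<open>
  Every morphism \<open>C : T \<rightarrow> U\<close> of plain representations between orthoscalar representations with the
  same character already intertwines the adjoints. Indeed, with Hilbert-Schmidt norms, expanding
  \<open>\<Sum>\<^sub>\<alpha> \<parallel>C T\<^sub>\<alpha>\<^sup>* - U\<^sub>\<alpha>\<^sup>* C\<parallel>\<^sup>2\<close> over all arrows and using the two orthoscalarity conditions gives
  \<open>\<Sum>\<^sub>W \<chi>\<^sub>j \<parallel>C\<^sub>j\<parallel>\<^sup>2 - \<Sum>\<^sub>B \<chi>\<^sub>i \<parallel>C\<^sub>i\<parallel>\<^sup>2\<close>, and both of these sums equal
  \<open>\<Sum>\<^sub>\<alpha> \<parallel>C T\<^sub>\<alpha>\<parallel>\<^sup>2 = \<Sum>\<^sub>\<alpha> \<parallel>U\<^sub>\<alpha> C\<parallel>\<^sup>2\<close>. So equivalence is the same in both categories.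

  For an endomorphism \<open>C\<close> of \<open>T\<close> and an eigenvalue \<open>c\<close> at some vertex, the spaces \<open>ker (C\<^sub>i - c)\<close> are
  therefore invariant under all maps of \<open>T\<close> and their adjoints, and \<open>T\<close> is the orthogonal sum of this
  subrepresentation and its complement. If \<open>T\<close> is indecomposable as an orthoscalar representation,
  then \<open>C\<close> is the scalar \<open>c\<close>; hence \<open>T\<close> is a brick, and has no nontrivial idempotent endomorphism.
\<close>

section \<open>Finite-dimensional subspaces and inner products\<close>

locale complex_vector_space = vector_space scale
  for scale :: "complex \<Rightarrow> 'a::ab_group_add \<Rightarrow> 'a"
begin

text \<open>A maximal independent subset of \<open>U\<close> spans \<open>U\<close>, and the
  exchange bound against the finite spanning set of \<open>V\<close> makes it finite.\<close>

lemma findim_subspace_subset: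
  assumes "findim_subspace scale V" and "subspace U" and "U \<subseteq> V"
  shows "findim_subspace scale U"
proof -
  obtain A where A: "finite A" "V = span A"
    using assms(1) unfolding findim_subspace_def by blast
  obtain E where E: "E \<subseteq> U" "independent E" "U \<subseteq> span E"
    using maximal_independent_subset by blast
  have "finite E"
    using independent_span_bound[OF A(1) E(2)] E(1) A(2) assms(3) by blast
  moreover have "U = span E"
    using E(1,3) assms(2) by (simp add: span_minimal subset_antisym)
  ultimately show ?thesis
    using assms(2) unfolding findim_subspace_def by blast
qed

lemma linear_between_0:
  assumes "linear_between scale V s' V' C" and "subspace V" and "vector_space s'"
  shows "C 0 = 0"
proof -
  interpret t: vector_space s' by fact
  have "C (scale 0 0) = s' 0 (C 0)"
    using assms(1) subspace_0[OF assms(2)] unfolding linear_between_def by blast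
  then show ?thesis by simp
qed

lemma linear_between_sum:
  assumes lin: "linear_between scale V s' V' C" and "subspace V" and "vector_space s'"
    and "\<And>e. e \<in> E \<Longrightarrow> x e \<in> V"
  shows "C (\<Sum>e\<in>E. scale (c e) (x e)) = (\<Sum>e\<in>E. s' (c e) (C (x e)))"
proof (cases "finite E")
  case True
  then show ?thesis
    using assms(4)
  proof (induction E)
    case empty
    then show ?case by (simp add: linear_between_0[OF assms(1-3)])
  next
    case (insert e F)
    have "scale (c e) (x e) \<in> V" "(\<Sum>e\<in>F. scale (c e) (x e)) \<in> V"
      using insert.prems assms(2) by (auto intro!: subspace_sum subspace_scale)
    then have "C (\<Sum>e\<in>insert e F. scale (c e) (x e))
        = C (scale (c e) (x e)) + C (\<Sum>e\<in>F. scale (c e) (x e))"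
      using lin insert.hyps by (simp add: linear_between_def)
    moreover have "C (scale (c e) (x e)) = s' (c e) (C (x e))"
      using lin insert.prems by (simp add: linear_between_def)
    ultimately show ?case
      using insert by simp
  qed
qed (simp add: linear_between_0[OF assms(1-3)])

section \<open>Annihilating polynomials and eigenvectors\<close>

text \<open>With \<open>V\<close> spanned by a finite \<open>A\<close>, the
  \<open>card A + 1\<close> iterates of \<open>v\<close> up to exponent \<open>card A\<close>
  satisfy a nontrivial linear relation; its coefficients form \<open>p\<close>.\<close>

lemma poly_annihilates_vector:
  assumes fin: "findim_subspace scale V"
    and lin: "\<And>k. (C ^^ k) v \<in> V"
  shows "\<exists>p :: complex poly. p \<noteq> 0 \<and> (\<Sum>k\<le>degree p. scale (coeff p k) ((C ^^ k) v)) = 0"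
proof -
  obtain A where A: "finite A" "V = span A"
    using fin unfolding findim_subspace_def by blast
  let ?x = "\<lambda>k. (C ^^ k) v"
  let ?K = "{..card A}"
  \<comment> \<open>\<open>dependent\<close> speaks of sets, whereas the relation wanted is indexed
    by exponents. If two iterates coincide, their difference is the relation.\<close>
  obtain u :: "nat \<Rightarrow> complex" where u: "\<exists>k\<in>?K. u k \<noteq> 0" "(\<Sum>k\<in>?K. scale (u k) (?x k)) = 0"
  proof (cases "inj_on ?x ?K")
    case True
    then have "card (?x ` ?K) = card A + 1"
      by (simp add: card_image)
    then have "dependent (?x ` ?K)"
      using independent_span_bound[OF A(1), of "?x ` ?K"] lin A(2) by fastforce
    then obtain w where w: "\<exists>y\<in>?x ` ?K. w y \<noteq> 0" "(\<Sum>y\<in>?x ` ?K. scale (w y) y) = 0"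
      using dependent_finite[of "?x ` ?K"] by auto
    show ?thesis
      using w by (intro that[of "\<lambda>k. w (?x k)"]) (auto simp: sum.reindex[OF True])
  next
    case False
    then obtain i j where ij: "i \<in> ?K" "j \<in> ?K" "i \<noteq> j" "?x i = ?x j"
      unfolding inj_on_def by blast
    let ?u = "\<lambda>k. (if k = i then 1 else 0) - (if k = j then 1 else 0 :: complex)"
    have "scale (?u k) (?x k) = (if k = i then ?x k else 0) - (if k = j then ?x k else 0)" for k
      by simp
    then have "(\<Sum>k\<in>?K. scale (?u k) (?x k)) = ?x i - ?x j"
      using ij(1,2) by (simp add: sum_subtractf sum.delta)
    then show ?thesis
      using ij by (intro that[of ?u]) auto
  qed
  let ?p = "\<Sum>k\<in>?K. monom (u k) k"
  have co: "coeff ?p k = (if k \<in> ?K then u k else 0)" for k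
    by (simp add: coeff_sum sum.delta)
  have "?p \<noteq> 0"
    using u(1) co by (metis coeff_0)
  moreover have "degree ?p \<le> card A"
    by (rule degree_le) (simp add: co)
  then have "(\<Sum>k\<le>degree ?p. scale (coeff ?p k) (?x k)) = (\<Sum>k\<in>?K. scale (coeff ?p k) (?x k))"
    by (intro sum.mono_neutral_left) (auto simp: coeff_eq_0)
  then have "(\<Sum>k\<le>degree ?p. scale (coeff ?p k) (?x k)) = 0"
    using u(2) co by simp
  ultimately show ?thesis by blast
qed

end

text \<open>The eigenvector is \<open>q(C) v0\<close>, where \<open>(X - a) q\<close> has least
  degree among the nonzero polynomials killing a chosen nonzero vector \<open>v0\<close>: minimality
  keeps \<open>q(C) v0\<close> from vanishing, and \<open>C - a\<close> kills it.\<close>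

lemma exists_eigenvector:
  fixes s :: "complex \<Rightarrow> 'a::ab_group_add \<Rightarrow> 'a"
  assumes "vector_space s" and fin: "findim_subspace s V" and "V \<noteq> {0}"
    and lin: "linear_between s V s V C"
  shows "\<exists>lam. \<exists>x\<in>V. x \<noteq> 0 \<and> C x = s lam x"
proof -
  interpret complex_vector_space s by (simp add: complex_vector_space_def assms(1))
  have sub: "subspace V" using fin unfolding findim_subspace_def by blast
  have C: "C x \<in> V" if "x \<in> V" for x
    using lin that unfolding linear_between_def by blast
  have pow: "(C ^^ k) v \<in> V" if "v \<in> V" for k v
    using that C by (induction k) auto
  \<comment> \<open>\<open>ev p v\<close> is \<open>p(C) v\<close>. The next fact permits any
    summation bound not below the degree, so that polynomials of different degrees can be compared
    termwise.\<close>
  define ev where "ev p v = (\<Sum>k\<le>degree p. s (coeff p k) ((C ^^ k) v))" for p v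
  have ev: "ev p v = (\<Sum>k\<le>n. s (coeff p k) ((C ^^ k) v))" if "degree p \<le> n" for p v n
    unfolding ev_def using that by (intro sum.mono_neutral_left) (auto simp: coeff_eq_0)
  have ev_in: "ev p v \<in> V" if "v \<in> V" for p v
    unfolding ev_def using that pow sub by (auto intro!: subspace_sum subspace_scale)
  have ev_factor: "ev ([:- a, 1:] * q) v = C (ev q v) - s a (ev q v)" if v: "v \<in> V" for a q v
  proof -
    let ?n = "degree q"
    have "degree ([:- a, 1:] * q) \<le> Suc ?n"
      using degree_mult_le[of "[:- a, 1:]" q] by simp
    \<comment> \<open>The product is \<open>pCons 0 q\<close> minus \<open>a\<close> times
      \<open>q\<close>. The first part shifts exponents and yields \<open>C (ev q v)\<close>; in the
      second the term of exponent \<open>Suc ?n\<close> vanishes.\<close>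
    then have "ev ([:- a, 1:] * q) v
        = (\<Sum>k\<le>Suc ?n. s (coeff (pCons 0 q) k) ((C ^^ k) v)) - (\<Sum>k\<le>Suc ?n. s (a * coeff q k) ((C ^^ k) v))"
      by (simp only: ev sum_subtractf[symmetric]) (simp add: scale_left_diff_distrib[symmetric])
    also have "(\<Sum>k\<le>Suc ?n. s (coeff (pCons 0 q) k) ((C ^^ k) v)) = (\<Sum>k\<le>?n. s (coeff q k) (C ((C ^^ k) v)))"
      by (subst sum.atMost_Suc_shift) simp
    also have "\<dots> = C (ev q v)"
      unfolding ev_def using v by (intro linear_between_sum[OF lin sub assms(1), symmetric] pow)
    also have "(\<Sum>k\<le>Suc ?n. s (a * coeff q k) ((C ^^ k) v)) = s a (ev q v)"
      by (simp add: ev_def scale_sum_right coeff_eq_0)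
    finally show ?thesis .
  qed
  obtain v0 where v0: "v0 \<in> V" "v0 \<noteq> 0"
    using assms(3) subspace_0[OF sub] by blast
  have "\<exists>p. p \<noteq> 0 \<and> ev p v0 = 0"
    using poly_annihilates_vector[OF fin pow[OF v0(1)]] unfolding ev_def by blast
  \<comment> \<open>A root of an annihilating polynomial of least degree is an eigenvalue.\<close>
  then obtain p where p: "p \<noteq> 0" "ev p v0 = 0"
    and min: "\<And>q. q \<noteq> 0 \<and> ev q v0 = 0 \<Longrightarrow> degree p \<le> degree q"
    using ex_has_least_nat[of "\<lambda>p. p \<noteq> 0 \<and> ev p v0 = 0" _ degree] by blast
  have "degree p \<noteq> 0"
  proof
    assume "degree p = 0"
    then obtain c where "p = [:c:]"
      by (metis degree_eq_zeroE)
    then show False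
      using p v0 by (simp add: ev_def)
  qed
  then have "\<not> constant (poly p)"
    by (simp add: constant_degree)
  then obtain a where "poly p a = 0"
    using fundamental_theorem_of_algebra by blast
  then obtain q where q: "p = [:- a, 1:] * q"
    by (metis dvdE poly_eq_0_iff_dvd)
  then have "q \<noteq> 0" using p by auto
  then have "degree p = Suc (degree q)"
    unfolding q by (subst degree_mult_eq) auto
  then have "ev q v0 \<noteq> 0"
    using min \<open>q \<noteq> 0\<close> by fastforce
  then show ?thesis
    using p(2) ev_factor[OF v0(1), of a q] ev_in[OF v0(1), of q] q by fastforce
qed

section \<open>Inner products, orthonormal bases and orthogonal projection\<close>

lemma inner_product_on_subset:
  "inner_product_on s V f \<Longrightarrow> U \<subseteq> V \<Longrightarrow> inner_product_on s U f"
  unfolding inner_product_on_def by blast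

text \<open>The form is controlled only on \<open>V\<close>; its values elsewhere in the ambient
  type are arbitrary. Hence the laws below are relative to membership, and one type can carry a
  different form for each vertex.\<close>

locale fd_inner_product =
  complex_vector_space scale for scale :: "complex \<Rightarrow> 'a::ab_group_add \<Rightarrow> 'a" (infixr \<open>*s\<close> 75) +
  fixes V :: "'a set" and ip :: "'a \<Rightarrow> 'a \<Rightarrow> complex" (\<open>\<langle>_, _\<rangle>\<close>)
  assumes findim: "findim_subspace scale V"
    and inner: "inner_product_on scale V ip"
begin

lemma sub: "subspace V"
  using findim unfolding findim_subspace_def by blast

lemma ip_add: "\<lbrakk>x \<in> V; y \<in> V; z \<in> V\<rbrakk> \<Longrightarrow> \<langle>x + y, z\<rangle> = \<langle>x, z\<rangle> + \<langle>y, z\<rangle>"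
  and ip_scale: "\<lbrakk>x \<in> V; y \<in> V\<rbrakk> \<Longrightarrow> \<langle>c *s x, y\<rangle> = c * \<langle>x, y\<rangle>"
  and ip_cnj: "\<lbrakk>x \<in> V; y \<in> V\<rbrakk> \<Longrightarrow> \<langle>y, x\<rangle> = cnj \<langle>x, y\<rangle>"
  and ip_pos: "\<lbrakk>x \<in> V; x \<noteq> 0\<rbrakk> \<Longrightarrow> \<langle>x, x\<rangle> \<in> \<real> \<and> 0 < Re \<langle>x, x\<rangle>"
  using inner unfolding inner_product_on_def by blast+

lemma ip_zero: "y \<in> V \<Longrightarrow> \<langle>0, y\<rangle> = 0"
  using ip_scale[of 0 y 0] subspace_0[OF sub] by simp

lemma ip_zero_right: "y \<in> V \<Longrightarrow> \<langle>y, 0\<rangle> = 0"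
  using ip_cnj[of 0 y] subspace_0[OF sub] by (simp add: ip_zero)

lemma ip_eq_0: "x \<in> V \<Longrightarrow> \<langle>x, x\<rangle> = 0 \<longleftrightarrow> x = 0"
  using ip_pos ip_zero by force

lemma ip_scale_right: "\<lbrakk>x \<in> V; y \<in> V\<rbrakk> \<Longrightarrow> \<langle>x, c *s y\<rangle> = cnj c * \<langle>x, y\<rangle>"
  using ip_scale[of y x c] ip_cnj[of "c *s y" x] ip_cnj[of y x] sub
  by (simp add: subspace_scale)

lemma ip_add_right: "\<lbrakk>x \<in> V; y \<in> V; z \<in> V\<rbrakk> \<Longrightarrow> \<langle>z, x + y\<rangle> = \<langle>z, x\<rangle> + \<langle>z, y\<rangle>"
  using ip_add[of x y z] ip_cnj[of "x + y" z] ip_cnj[of x z] ip_cnj[of y z] sub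
  by (simp add: subspace_add)

lemma ip_diff: "\<lbrakk>x \<in> V; y \<in> V; z \<in> V\<rbrakk> \<Longrightarrow> \<langle>x - y, z\<rangle> = \<langle>x, z\<rangle> - \<langle>y, z\<rangle>"
  using ip_add[of "x - y" y z] sub by (simp add: subspace_diff)

lemma ip_diff_right: "\<lbrakk>x \<in> V; y \<in> V; z \<in> V\<rbrakk> \<Longrightarrow> \<langle>z, x - y\<rangle> = \<langle>z, x\<rangle> - \<langle>z, y\<rangle>"
  using ip_add_right[of "x - y" y z] sub by (simp add: subspace_diff)

lemma ip_sum:
  assumes "\<And>e. e \<in> E \<Longrightarrow> x e \<in> V" and "y \<in> V"
  shows "\<langle>\<Sum>e\<in>E. x e, y\<rangle> = (\<Sum>e\<in>E. \<langle>x e, y\<rangle>)"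
  using assms
proof (induction E rule: infinite_finite_induct)
  case (insert e F)
  then have "(\<Sum>e\<in>F. x e) \<in> V"
    using sub by (auto intro!: subspace_sum)
  then show ?case
    using insert by (simp add: ip_add)
qed (simp_all add: ip_zero)

lemma ip_sum_right:
  assumes "\<And>e. e \<in> E \<Longrightarrow> x e \<in> V" and "y \<in> V"
  shows "\<langle>y, \<Sum>e\<in>E. x e\<rangle> = (\<Sum>e\<in>E. \<langle>y, x e\<rangle>)"
  using assms
proof (induction E rule: infinite_finite_induct)
  case (insert e F)
  then have "(\<Sum>e\<in>F. x e) \<in> V"
    using sub by (auto intro!: subspace_sum)
  then show ?case
    using insert by (simp add: ip_add_right)
qed (simp_all add: ip_zero_right)

lemma ip_eqI:
  assumes "x \<in> V" "y \<in> V" and "\<And>v. v \<in> V \<Longrightarrow> \<langle>v, x\<rangle> = \<langle>v, y\<rangle>"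
  shows "x = y"
proof -
  have d: "x - y \<in> V" using assms(1,2) sub by (simp add: subspace_diff)
  have "\<langle>x - y, x - y\<rangle> = 0"
    using assms(3)[OF d] by (simp add: ip_diff_right assms(1,2) d)
  then show ?thesis using ip_eq_0[OF d] by simp
qed

definition orthonormal :: "'a set \<Rightarrow> bool" where
  "orthonormal E \<longleftrightarrow> finite E \<and> (\<forall>e\<in>E. \<forall>f\<in>E. \<langle>e, f\<rangle> = (if e = f then 1 else 0))"

text \<open>Each new vector splits into its projection onto the span so far and an orthogonal
  remainder. A zero remainder adds nothing to the span; any other is normalised and
  adjoined.\<close>

lemma Gram_Schmidt:
  assumes "finite A" and "A \<subseteq> V"
  shows "\<exists>E. orthonormal E \<and> span E = span A"
  using assms
proof (induction A)
  case empty
  then show ?case by (intro exI[of _ "{}"]) (simp add: orthonormal_def)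
next
  case (insert a A)
  then obtain E where E: "orthonormal E" "span E = span A" by auto
  have EV: "E \<subseteq> V" and a: "a \<in> V"
    using E(2) insert.prems sub span_superset span_minimal by (metis dual_order.trans insert_subset)+
  define p where "p = (\<Sum>e\<in>E. \<langle>a, e\<rangle> *s e)"
  define b where "b = a - p"
  have p: "p \<in> span E"
    unfolding p_def by (intro span_sum span_scale span_base)
  then have pV: "p \<in> V"
    using EV sub span_minimal by blast
  then have bV: "b \<in> V"
    using a sub unfolding b_def by (simp add: subspace_diff)
  have spab: "span (insert a A) = span (insert b E)"
  proof -
    have "span (insert a A) = span (insert a E)"
      by (metis E(2) span_insert)
    also have "\<dots> = span (insert b E)"
      unfolding b_def using p by (intro eq_span_insert_eq) simp
    finally show ?thesis .
  qed
  have orth: "\<langle>b, f\<rangle> = 0" if "f \<in> E" for f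
  proof -
    have "\<langle>p, f\<rangle> = (\<Sum>e\<in>E. \<langle>\<langle>a, e\<rangle> *s e, f\<rangle>)"
      unfolding p_def using that EV sub by (intro ip_sum) (auto intro: subspace_scale)
    also have "\<dots> = (\<Sum>e\<in>E. if e = f then \<langle>a, f\<rangle> else 0)"
      using that EV E(1) by (intro sum.cong) (auto simp: ip_scale orthonormal_def subset_iff)
    also have "\<dots> = \<langle>a, f\<rangle>"
      using that E(1) by (simp add: orthonormal_def)
    finally show ?thesis
      unfolding b_def using that EV a pV by (simp add: ip_diff subset_iff)
  qed
  show ?case
  proof (cases "b = 0")
    case True
    then have "span (insert a A) = span E"
      using spab by (metis insert_absorb2 span_insert_0)
    then show ?thesis using E(1) by blast
  next
    case False
    define r where "r = Re \<langle>b, b\<rangle>"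
    have r: "r > 0" "\<langle>b, b\<rangle> = of_real r"
      using ip_pos[OF bV False] by (auto simp: r_def complex_is_Real_iff complex_eq_iff)
    \<comment> \<open>\<open>c\<close> is real, so it leaves the second argument unconjugated and
      \<open>c *s b\<close> has norm one.\<close>
    define c where "c = complex_of_real (1 / sqrt r)"
    have c: "c \<noteq> 0" "cnj c = c" "c * (c * of_real r) = 1"
    proof -
      show "c \<noteq> 0" "cnj c = c" using r unfolding c_def by auto
      have "1 / sqrt r * (1 / sqrt r * r) = 1"
        using r(1) by (simp add: field_simps)
      then show "c * (c * of_real r) = 1"
        unfolding c_def by (metis of_real_1 of_real_mult)
    qed
    have cb: "c *s b \<in> V" using bV sub by (simp add: subspace_scale)
    have "\<langle>c *s b, c *s b\<rangle> = 1"
      using c r bV cb by (simp add: ip_scale ip_scale_right)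
    moreover have "\<langle>c *s b, f\<rangle> = 0" "\<langle>f, c *s b\<rangle> = 0" if "f \<in> E" for f
      using orth[OF that] that bV EV cb ip_cnj[of b f] by (auto simp: ip_scale ip_scale_right)
    ultimately have "orthonormal (insert (c *s b) E)"
      using E(1) unfolding orthonormal_def by force
    moreover have "span (insert (c *s b) E) = span (insert b E)"
    proof (intro span_eq[THEN iffD2] conjI insert_subsetI)
      show "c *s b \<in> span (insert b E)" by (simp add: span_base span_scale)
      have "inverse c *s (c *s b) \<in> span (insert (c *s b) E)"
        by (intro span_scale span_base) simp
      then show "b \<in> span (insert (c *s b) E)" using c(1) by simp
    qed (auto intro: span_base)
    ultimately show ?thesis using spab by blast
  qed
qed

text \<open>Spanning is encoded as the Fourier expansion, the form in which later computations use a
  basis.\<close>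

definition orthonormal_basis :: "'a set \<Rightarrow> bool" where
  "orthonormal_basis E \<longleftrightarrow> orthonormal E \<and> E \<subseteq> V \<and> (\<forall>x\<in>V. x = (\<Sum>e\<in>E. \<langle>x, e\<rangle> *s e))"

lemma orthonormal_basisD:
  assumes "orthonormal_basis E"
  shows "finite E" "E \<subseteq> V" "\<And>x. x \<in> V \<Longrightarrow> (\<Sum>e\<in>E. \<langle>x, e\<rangle> *s e) = x"
  using assms unfolding orthonormal_basis_def orthonormal_def by simp_all

lemma orthonormal_basis_exists: "\<exists>E. orthonormal_basis E"
proof -
  obtain A where A: "finite A" "V = span A"
    using findim unfolding findim_subspace_def by blast
  then obtain E where E: "orthonormal E" "span E = V"
    using Gram_Schmidt[of A] span_superset by auto
  have EV: "E \<subseteq> V" using E(2) span_superset by blast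
  have "x = (\<Sum>e\<in>E. \<langle>x, e\<rangle> *s e)" if x: "x \<in> V" for x
  proof -
    \<comment> \<open>Some expansion exists because \<open>E\<close> spans \<open>V\<close>; pairing
      it with a basis vector identifies the coefficients.\<close>
    obtain u where u: "x = (\<Sum>e\<in>E. u e *s e)"
      using x E span_finite[of E] unfolding orthonormal_def by auto
    have "\<langle>x, f\<rangle> = u f" if "f \<in> E" for f
    proof -
      have "\<langle>x, f\<rangle> = (\<Sum>e\<in>E. \<langle>u e *s e, f\<rangle>)"
        unfolding u using that EV sub by (intro ip_sum) (auto intro: subspace_scale)
      also have "\<dots> = (\<Sum>e\<in>E. if e = f then u f else 0)"
        using that EV E(1) by (intro sum.cong) (auto simp: ip_scale orthonormal_def subset_iff)
      also have "\<dots> = u f"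
        using that E(1) by (simp add: orthonormal_def)
      finally show ?thesis .
    qed
    then show ?thesis using u by simp
  qed
  then show ?thesis
    using E(1) EV unfolding orthonormal_basis_def by blast
qed

text \<open>\<open>y\<close> is the orthogonal projection of \<open>x\<close>, computed in an
  orthonormal basis of \<open>U\<close>, which is itself an inner product space under the same
  form.\<close>

lemma orthogonal_decomposition:
  assumes "subspace U" and "U \<subseteq> V" and "x \<in> V"
  shows "\<exists>y\<in>U. \<exists>z\<in>V. (\<forall>u\<in>U. \<langle>z, u\<rangle> = 0) \<and> x = y + z"
proof -
  interpret U: fd_inner_product scale U ip
  proof
    show "findim_subspace scale U"
      using findim_subspace_subset[OF findim assms(1,2)] .
    show "inner_product_on scale U ip"
      using inner_product_on_subset[OF inner assms(2)] .
  qed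
  obtain E where E: "U.orthonormal_basis E" using U.orthonormal_basis_exists by blast
  note EU = U.orthonormal_basisD[OF E]
  let ?y = "\<Sum>e\<in>E. \<langle>x, e\<rangle> *s e"
  have y: "?y \<in> U"
    using EU(2) assms(1) by (auto intro!: subspace_sum subspace_scale)
  have z: "x - ?y \<in> V"
    using y assms(2,3) sub by (auto intro: subspace_diff)
  have "\<langle>x - ?y, u\<rangle> = 0" if u: "u \<in> U" for u
  proof -
    \<comment> \<open>Expanding \<open>u\<close> in the same basis shows that \<open>?y\<close> and
      \<open>x\<close> have the same inner product with \<open>u\<close>.\<close>
    have "\<langle>?y, u\<rangle> = (\<Sum>e\<in>E. \<langle>x, e\<rangle> * \<langle>e, u\<rangle>)"
      using EU(2) u assms(1)
      by (subst U.ip_sum) (auto simp: U.ip_scale subset_iff intro!: subspace_scale)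
    also have "\<dots> = (\<Sum>e\<in>E. \<langle>x, \<langle>u, e\<rangle> *s e\<rangle>)"
    proof (intro sum.cong refl)
      fix e assume "e \<in> E"
      then have "e \<in> V" "u \<in> V" using EU(2) u assms(2) by auto
      then show "\<langle>x, e\<rangle> * \<langle>e, u\<rangle> = \<langle>x, \<langle>u, e\<rangle> *s e\<rangle>"
        using ip_cnj[of u e] by (simp add: ip_scale_right assms(3))
    qed
    also have "\<dots> = \<langle>x, \<Sum>e\<in>E. \<langle>u, e\<rangle> *s e\<rangle>"
      using EU(2) assms by (intro ip_sum_right[symmetric]) (auto intro!: subspace_scale[OF sub])
    also have "\<dots> = \<langle>x, u\<rangle>"
      using EU(3)[OF u] by simp
    finally show ?thesis
      using y u assms(2,3) by (simp add: ip_diff subset_iff)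
  qed
  then show ?thesis
    using y z by (intro bexI[of _ ?y] bexI[of _ "x - ?y"]) auto
qed

end

context fd_inner_product
begin

text \<open>In an orthonormal basis the representing vector has coordinates
  \<open>cnj (g e)\<close>; the conjugation cancels the conjugate-linearity of the form in its
  second argument.\<close>

lemma Riesz:
  assumes "linear_between scale V (*) UNIV g"
  shows "\<exists>x\<in>V. \<forall>v\<in>V. g v = \<langle>v, x\<rangle>"
proof -
  have vs: "vector_space ((*) :: complex \<Rightarrow> complex \<Rightarrow> complex)"
    by unfold_locales (auto simp: algebra_simps)
  obtain E where "orthonormal_basis E" using orthonormal_basis_exists by blast
  note E = orthonormal_basisD[OF this]
  let ?x = "\<Sum>e\<in>E. cnj (g e) *s e"
  have x: "?x \<in> V" using E(2) sub by (auto intro!: subspace_sum subspace_scale)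
  moreover have "g v = \<langle>v, ?x\<rangle>" if v: "v \<in> V" for v
  proof -
    have "\<langle>v, ?x\<rangle> = (\<Sum>e\<in>E. \<langle>v, e\<rangle> * g e)"
      using E(2) v sub
      by (subst ip_sum_right) (auto simp: ip_scale_right subset_iff mult.commute intro!: subspace_scale sum.cong)
    also have "\<dots> = g (\<Sum>e\<in>E. \<langle>v, e\<rangle> *s e)"
      using E(2) by (subst linear_between_sum[OF assms sub vs]) auto
    finally show ?thesis using E(3)[OF v] by simp
  qed
  ultimately show ?thesis by blast
qed

end

section \<open>Linear maps and Hilbert-Schmidt sums\<close>

lemma linear_between_comp:
  assumes "linear_between s V s' V' f" and "linear_between s' V' s'' V'' g"
  shows "linear_between s V s'' V'' (\<lambda>x. g (f x))"
  using assms unfolding linear_between_def by simp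

lemma linear_between_id: "linear_between s V s V (\<lambda>x. x)"
  unfolding linear_between_def by simp

lemma linear_between_in: "linear_between s V s' V' f \<Longrightarrow> x \<in> V \<Longrightarrow> f x \<in> V'"
  unfolding linear_between_def by blast

text \<open>Both sides are \<open>tr (A R R\<^sup>* A\<^sup>*)\<close>.\<close>

lemma sum_norm_comp_adjoint:
  assumes U: "fd_inner_product s U g" and V: "fd_inner_product s V f"
    and Z: "fd_inner_product s' Z h"
    and R: "linear_between s U s V R" and R'_in: "\<And>v. v \<in> V \<Longrightarrow> R' v \<in> U"
    and adj: "\<And>u v. u \<in> U \<Longrightarrow> v \<in> V \<Longrightarrow> f (R u) v = g u (R' v)"
    and A: "linear_between s V s' Z A"
    and E: "fd_inner_product.orthonormal_basis s U g E"
    and F: "fd_inner_product.orthonormal_basis s V f F"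
  shows "(\<Sum>y\<in>E. h (A (R y)) (A (R y))) = (\<Sum>x\<in>F. h (A (R (R' x))) (A x))"
proof -
  interpret U: fd_inner_product s U g by fact
  interpret V: fd_inner_product s V f by fact
  interpret Z: fd_inner_product s' Z h by fact
  note E = U.orthonormal_basisD[OF E] and F = V.orthonormal_basisD[OF F]
  have vs: "vector_space s'" by unfold_locales
  note AR = linear_between_comp[OF R A]
  note [simp] = linear_between_in[OF R] linear_between_in[OF A] R'_in
  have EU: "y \<in> U" if "y \<in> E" for y using that E(2) by blast
  have FV: "x \<in> V" if "x \<in> F" for x using that F(2) by blast
  \<comment> \<open>Expand \<open>R y\<close> along \<open>F\<close> in the second argument. The
    coefficient \<open>f (R y) x\<close> comes out conjugated, and the adjoint relation turns it
    into \<open>g (R' x) y\<close>.\<close>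
  have 1: "h (A (R y)) (A (R y)) = (\<Sum>x\<in>F. g (R' x) y * h (A (R y)) (A x))" if y: "y \<in> E" for y
  proof -
    note yU = EU[OF y]
    have "A (R y) = A (\<Sum>x\<in>F. s (f (R y) x) x)"
      using F(3)[of "R y"] yU by simp
    also have "\<dots> = (\<Sum>x\<in>F. s' (f (R y) x) (A x))"
      by (rule U.linear_between_sum[OF A V.sub vs]) (rule FV)
    finally have "h (A (R y)) (A (R y)) = h (A (R y)) (\<Sum>x\<in>F. s' (f (R y) x) (A x))"
      by simp
    also have "\<dots> = (\<Sum>x\<in>F. h (A (R y)) (s' (f (R y) x) (A x)))"
      using yU FV by (intro Z.ip_sum_right Z.subspace_scale[OF Z.sub]) auto
    also have "\<dots> = (\<Sum>x\<in>F. g (R' x) y * h (A (R y)) (A x))"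
    proof (intro sum.cong refl)
      fix x assume x: "x \<in> F"
      then have "cnj (f (R y) x) = g (R' x) y"
        using adj[OF yU FV[OF x]] U.ip_cnj[of y "R' x"] yU FV[OF x] by simp
      then show "h (A (R y)) (s' (f (R y) x) (A x)) = g (R' x) y * h (A (R y)) (A x)"
        using yU FV[OF x] by (simp add: Z.ip_scale_right)
    qed
    finally show ?thesis .
  qed
  \<comment> \<open>The numbers \<open>g (R' x) y\<close> are the coordinates of \<open>R' x\<close>
    along \<open>E\<close>, so the sum over \<open>y\<close> reassembles \<open>R' x\<close>.
    Together with the first fact and an exchange of sums this gives the claim.\<close>
  have 2: "(\<Sum>y\<in>E. g (R' x) y * h (A (R y)) (A x)) = h (A (R (R' x))) (A x)" if x: "x \<in> F" for x
  proof -
    note xV = FV[OF x]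
    have "(\<Sum>y\<in>E. g (R' x) y * h (A (R y)) (A x)) = (\<Sum>y\<in>E. h (s' (g (R' x) y) (A (R y))) (A x))"
      using EU xV by (intro sum.cong) (auto simp: Z.ip_scale)
    also have "\<dots> = h (\<Sum>y\<in>E. s' (g (R' x) y) (A (R y))) (A x)"
      using EU xV by (intro Z.ip_sum[symmetric] Z.subspace_scale[OF Z.sub]) auto
    also have "(\<Sum>y\<in>E. s' (g (R' x) y) (A (R y))) = A (R (\<Sum>y\<in>E. s (g (R' x) y) y))"
      by (rule U.linear_between_sum[OF AR U.sub vs, symmetric]) (rule EU)
    also have "(\<Sum>y\<in>E. s (g (R' x) y) y) = R' x"
      using E(3)[of "R' x"] xV by simp
    finally show ?thesis .
  qed
  have "(\<Sum>y\<in>E. h (A (R y)) (A (R y))) = (\<Sum>y\<in>E. \<Sum>x\<in>F. g (R' x) y * h (A (R y)) (A x))"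
    using 1 by simp
  also have "\<dots> = (\<Sum>x\<in>F. \<Sum>y\<in>E. g (R' x) y * h (A (R y)) (A x))"
    by (rule sum.swap)
  also have "\<dots> = (\<Sum>x\<in>F. h (A (R (R' x))) (A x))"
    using 2 by simp
  finally show ?thesis .
qed

text \<open>Carries one orthoscalarity equation, in the role of \<open>eq\<close>, into a sum of
  inner products: linearity moves the sum over the arrows at a vertex through \<open>A\<close> and
  into the first argument of \<open>h\<close>.\<close>

lemma sum_ip_image:
  assumes V: "fd_inner_product s V f" and Z: "fd_inner_product s' Z h"
    and A: "linear_between s V s' Z A"
    and x: "\<And>a. a \<in> I \<Longrightarrow> x a \<in> V" and y: "y \<in> V" and eq: "(\<Sum>a\<in>I. x a) = s c y"
  shows "(\<Sum>a\<in>I. h (A (x a)) (A y)) = c * h (A y) (A y)"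
proof -
  interpret V: fd_inner_product s V f by fact
  interpret Z: fd_inner_product s' Z h by fact
  have vs: "vector_space s'" by unfold_locales
  note [simp] = linear_between_in[OF A] y
  have "(\<Sum>a\<in>I. h (A (x a)) (A y)) = h (\<Sum>a\<in>I. A (x a)) (A y)"
    using x by (intro Z.ip_sum[symmetric]) auto
  also have "(\<Sum>a\<in>I. A (x a)) = A (\<Sum>a\<in>I. x a)"
    using V.linear_between_sum[OF A V.sub vs, of I x "\<lambda>_. 1"] x by simp
  also have "\<dots> = s' c (A y)"
    using A y unfolding eq linear_between_def by blast
  finally show ?thesis by (simp add: Z.ip_scale)
qed

text \<open>Regroups a sum over arrows by endpoint. In the applications \<open>p\<close> is the head
  or tail map, \<open>E i\<close> a basis at the vertex \<open>i\<close>, and \<open>c i\<close> the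
  value of the character there.\<close>

lemma sum_fibres:
  fixes F :: "'a \<Rightarrow> 'b \<Rightarrow> complex"
  assumes "finite A" "finite K" "p ` A \<subseteq> K"
    and "\<And>i y. i \<in> K \<Longrightarrow> y \<in> E i \<Longrightarrow> (\<Sum>a | a \<in> A \<and> p a = i. F a y) = c i * G i y"
  shows "(\<Sum>a\<in>A. \<Sum>y\<in>E (p a). F a y) = (\<Sum>i\<in>K. c i * (\<Sum>y\<in>E i. G i y))"
proof -
  have "(\<Sum>a\<in>A. \<Sum>y\<in>E (p a). F a y) = (\<Sum>i\<in>K. \<Sum>a | a \<in> A \<and> p a = i. \<Sum>y\<in>E (p a). F a y)"
    by (rule sum.group[OF assms(1-3), symmetric])
  also have "\<dots> = (\<Sum>i\<in>K. \<Sum>a | a \<in> A \<and> p a = i. \<Sum>y\<in>E i. F a y)"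
    by (intro sum.cong) auto
  also have "\<dots> = (\<Sum>i\<in>K. \<Sum>y\<in>E i. \<Sum>a | a \<in> A \<and> p a = i. F a y)"
    by (intro sum.cong refl sum.swap)
  also have "\<dots> = (\<Sum>i\<in>K. c i * (\<Sum>y\<in>E i. G i y))"
    using assms(4) by (simp add: sum_distrib_left)
  finally show ?thesis .
qed

section \<open>Adjoints of the maps of a representation\<close>

lemma is_hrep_space:
  assumes "is_hrep Q T" "i \<in> verts Q"
  shows "fd_inner_product (scl T) (vspace T i) (ip T i)"
  using assms
  by (simp add: is_hrep_def is_rep_def fd_inner_product_def fd_inner_product_axioms_def
      complex_vector_space_def)

lemma is_rep_amap:
  assumes "is_rep Q T" "\<alpha> \<in> arcs Q"
  shows "linear_between (scl T) (vspace T (tail Q \<alpha>)) (scl T) (vspace T (head Q \<alpha>)) (amap T \<alpha>)"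
  using assms unfolding is_rep_def by blast

locale hrep_arc = wf_digraph Q for Q :: "('v, 'e) pre_digraph" +
  fixes T :: "('v, 'e, 'a::ab_group_add) hrep" and \<alpha>
  assumes hrep: "is_hrep Q T" and arc: "\<alpha> \<in> arcs Q"
begin

sublocale t: fd_inner_product "scl T" "vspace T (tail Q \<alpha>)" "ip T (tail Q \<alpha>)"
  using hrep arc by (simp add: is_hrep_space)

sublocale h: fd_inner_product "scl T" "vspace T (head Q \<alpha>)" "ip T (head Q \<alpha>)"
  using hrep arc by (simp add: is_hrep_space)

lemma amap_linear:
  "linear_between (scl T) (vspace T (tail Q \<alpha>)) (scl T) (vspace T (head Q \<alpha>)) (amap T \<alpha>)"
  using hrep arc by (simp add: is_rep_amap is_hrep_def)

lemma amap_in: "x \<in> vspace T (tail Q \<alpha>) \<Longrightarrow> amap T \<alpha> x \<in> vspace T (head Q \<alpha>)"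
  by (rule linear_between_in[OF amap_linear])

text \<open>The means of computing \<open>adj\<close>: a vector of the tail space is determined by
  its inner products, so exhibiting one candidate settles the definite description.\<close>

lemma adj_unique:
  assumes "x \<in> vspace T (tail Q \<alpha>)"
    and "\<And>v. v \<in> vspace T (tail Q \<alpha>) \<Longrightarrow>
      ip T (head Q \<alpha>) (amap T \<alpha> v) y = ip T (tail Q \<alpha>) v x"
  shows "adj Q T \<alpha> y = x"
  unfolding adj_def using assms by (intro the_equality) (auto intro!: t.ip_eqI)

text \<open>Riesz representation of the functional pairing the image of \<open>v\<close> with
  \<open>y\<close> supplies the candidate.\<close>

lemma
  assumes y: "y \<in> vspace T (head Q \<alpha>)"
  shows adj_in: "adj Q T \<alpha> y \<in> vspace T (tail Q \<alpha>)"
    and adj_ip: "\<And>v. v \<in> vspace T (tail Q \<alpha>) \<Longrightarrow>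
      ip T (head Q \<alpha>) (amap T \<alpha> v) y = ip T (tail Q \<alpha>) v (adj Q T \<alpha> y)"
proof -
  have "linear_between (scl T) (vspace T (tail Q \<alpha>)) (*) UNIV
      (\<lambda>v. ip T (head Q \<alpha>) (amap T \<alpha> v) y)"
    using amap_linear y by (simp add: linear_between_def h.ip_add h.ip_scale)
  then obtain x where x: "x \<in> vspace T (tail Q \<alpha>)"
    "\<And>v. v \<in> vspace T (tail Q \<alpha>) \<Longrightarrow>
      ip T (head Q \<alpha>) (amap T \<alpha> v) y = ip T (tail Q \<alpha>) v x"
    using t.Riesz by blast
  have eq: "adj Q T \<alpha> y = x" by (rule adj_unique[OF x])
  show "adj Q T \<alpha> y \<in> vspace T (tail Q \<alpha>)"
    and "\<And>v. v \<in> vspace T (tail Q \<alpha>) \<Longrightarrow>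
      ip T (head Q \<alpha>) (amap T \<alpha> v) y = ip T (tail Q \<alpha>) v (adj Q T \<alpha> y)"
    unfolding eq by (rule x)+
qed

lemma adj_ip':
  assumes "y \<in> vspace T (head Q \<alpha>)" "v \<in> vspace T (tail Q \<alpha>)"
  shows "ip T (tail Q \<alpha>) (adj Q T \<alpha> y) v = ip T (head Q \<alpha>) y (amap T \<alpha> v)"
  using adj_ip[OF assms] h.ip_cnj[OF amap_in[OF assms(2)] assms(1)]
    t.ip_cnj[OF assms(2) adj_in[OF assms(1)]] by simp

lemma adj_linear:
  "linear_between (scl T) (vspace T (head Q \<alpha>)) (scl T) (vspace T (tail Q \<alpha>)) (adj Q T \<alpha>)"
  unfolding linear_between_def
proof (intro conjI ballI allI)
  fix x y assume xy: "x \<in> vspace T (head Q \<alpha>)" "y \<in> vspace T (head Q \<alpha>)"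
  show "adj Q T \<alpha> (x + y) = adj Q T \<alpha> x + adj Q T \<alpha> y"
    using xy by (intro adj_unique)
      (simp_all add: adj_in amap_in adj_ip h.ip_add_right t.ip_add_right t.subspace_add[OF t.sub])
next
  fix c x assume x: "x \<in> vspace T (head Q \<alpha>)"
  show "adj Q T \<alpha> (scl T c x) = scl T c (adj Q T \<alpha> x)"
    using x by (intro adj_unique)
      (simp_all add: adj_in amap_in adj_ip h.ip_scale_right t.ip_scale_right t.subspace_scale[OF t.sub])
qed (rule adj_in)

end

lemma hrep_arcI: "wf_digraph Q \<Longrightarrow> is_hrep Q T \<Longrightarrow> \<alpha> \<in> arcs Q \<Longrightarrow> hrep_arc Q T \<alpha>"
  by (simp add: hrep_arc_def hrep_arc_axioms_def)

section \<open>Morphisms between orthoscalar representations\<close>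

lemma RepHom_linear:
  assumes "C \<in> RepHom Q T U" "i \<in> verts Q"
  shows "linear_between (scl T) (vspace T i) (scl U) (vspace U i) (C i)"
  using assms unfolding RepHom_def by blast

lemma RepHom_commute:
  assumes "C \<in> RepHom Q T U" "\<alpha> \<in> arcs Q" "x \<in> vspace T (tail Q \<alpha>)"
  shows "C (head Q \<alpha>) (amap T \<alpha> x) = amap U \<alpha> (C (tail Q \<alpha>) x)"
  using assms unfolding RepHom_def by blast

text \<open>Stated for arbitrary morphisms, so that it applies both to the two halves of an
  equivalence and to endomorphisms.\<close>

lemma RepHom_orthoscalar:
  fixes T :: "('v, 'e, 'a::ab_group_add) hrep" and U :: "('v, 'e, 'b::ab_group_add) hrep"
  assumes "fin_digraph Q" and sep: "separated Q W B"
    and osT: "orthoscalar Q W B \<chi> T" and osU: "orthoscalar Q W B \<chi> U"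
    and C: "C \<in> RepHom Q T U"
  shows "C \<in> HRepHom Q T U"
proof -
  interpret fin_digraph Q by fact
  have wf: "wf_digraph Q" by unfold_locales
  have hT: "is_hrep Q T" and hU: "is_hrep Q U"
    using osT osU unfolding orthoscalar_def by blast+
  have fin: "finite W" "finite B" and WB: "W \<subseteq> verts Q" "B \<subseteq> verts Q"
    and tW: "tail Q ` arcs Q \<subseteq> W" and hB: "head Q ` arcs Q \<subseteq> B"
    using sep finite_verts unfolding separated_def by (auto dest: sym)
  note aT = hrep_arcI[OF wf hT] and aU = hrep_arcI[OF wf hU]
  note spT = is_hrep_space[OF hT] and spU = is_hrep_space[OF hU]
  note Clin = RepHom_linear[OF C] and Ccomm = RepHom_commute[OF C]
  note Cin = linear_between_in[OF Clin]
  have "\<forall>i\<in>verts Q. \<exists>E. fd_inner_product.orthonormal_basis (scl T) (vspace T i) (ip T i) E"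
    using fd_inner_product.orthonormal_basis_exists[OF spT] by blast
  then obtain E where E: "\<And>i. i \<in> verts Q \<Longrightarrow>
      fd_inner_product.orthonormal_basis (scl T) (vspace T i) (ip T i) (E i)"
    by metis
  have EV: "x \<in> vspace T i" if "x \<in> E i" "i \<in> verts Q" for i x
    using fd_inner_product.orthonormal_basisD(2)[OF spT E] that by blast
  let ?t = "tail Q" and ?h = "head Q"
  let ?R = "amap T" and ?R' = "adj Q T" and ?S = "amap U" and ?S' = "adj Q U"
  \<comment> \<open>\<open>n i\<close> is the squared Hilbert-Schmidt norm of \<open>C i\<close>,
    kept as a complex number. \<open>P\<close> is the black weighted sum; the white one is shown to
    agree with it in \<open>WP\<close>.\<close>
  define n where "n i = (\<Sum>x\<in>E i. ip U i (C i x) (C i x))" for i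
  define P where "P = (\<Sum>i\<in>B. of_real (\<chi> i) * n i)"
  have sumB: "(\<Sum>\<alpha>\<in>in_arcs Q i. amap T \<alpha> (adj Q T \<alpha> x)) = scl T (of_real (\<chi> i)) x"
    if "i \<in> B" "x \<in> vspace T i" for i x
    using osT that unfolding orthoscalar_def by blast
  have sumW: "(\<Sum>\<alpha>\<in>out_arcs Q i. adj Q T \<alpha> (amap T \<alpha> x)) = scl T (of_real (\<chi> i)) x"
    if "i \<in> W" "x \<in> vspace T i" for i x
    using osT that unfolding orthoscalar_def by blast
  have sumB': "(\<Sum>\<alpha>\<in>in_arcs Q i. amap U \<alpha> (adj Q U \<alpha> x)) = scl U (of_real (\<chi> i)) x"
    if "i \<in> B" "x \<in> vspace U i" for i x
    using osU that unfolding orthoscalar_def by blast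
  have sumW': "(\<Sum>\<alpha>\<in>out_arcs Q i. adj Q U \<alpha> (amap U \<alpha> x)) = scl U (of_real (\<chi> i)) x"
    if "i \<in> W" "x \<in> vspace U i" for i x
    using osU that unfolding orthoscalar_def by blast

  \<comment> \<open>Four sums over arrows follow, each regrouped by head or tail and evaluated by
    one orthoscalarity condition. The first two use the conditions of \<open>T\<close> inside
    \<open>C\<close>.\<close>
  have black: "(\<Sum>\<alpha>\<in>arcs Q. \<Sum>y\<in>E (?h \<alpha>).
      ip U (?h \<alpha>) (C (?h \<alpha>) (?R \<alpha> (?R' \<alpha> y))) (C (?h \<alpha>) y)) = P"
    unfolding P_def n_def
  proof (rule sum_fibres[OF finite_arcs fin(2) hB, where F = "\<lambda>\<alpha> y.
      ip U (?h \<alpha>) (C (?h \<alpha>) (?R \<alpha> (?R' \<alpha> y))) (C (?h \<alpha>) y)"])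
    fix i y assume i: "i \<in> B" and y: "y \<in> E i"
    have iv: "i \<in> verts Q" and yV: "y \<in> vspace T i" using i y WB EV by blast+
    have "(\<Sum>\<alpha>\<in>in_arcs Q i. ip U i (C i (?R \<alpha> (?R' \<alpha> y))) (C i y))
        = of_real (\<chi> i) * ip U i (C i y) (C i y)"
      using hrep_arc.amap_in[OF aT] hrep_arc.adj_in[OF aT] yV
      by (intro sum_ip_image[OF spT[OF iv] spU[OF iv] Clin[OF iv]] sumB i)
         (auto simp: in_arcs_def)
    then show "(\<Sum>\<alpha> | \<alpha> \<in> arcs Q \<and> ?h \<alpha> = i.
        ip U (?h \<alpha>) (C (?h \<alpha>) (?R \<alpha> (?R' \<alpha> y))) (C (?h \<alpha>) y))
        = of_real (\<chi> i) * ip U i (C i y) (C i y)"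
      by (rule trans[rotated]) (auto simp: in_arcs_def intro!: sum.cong)
  qed
  have white: "(\<Sum>\<alpha>\<in>arcs Q. \<Sum>x\<in>E (?t \<alpha>).
      ip U (?t \<alpha>) (C (?t \<alpha>) (?R' \<alpha> (?R \<alpha> x))) (C (?t \<alpha>) x)) = (\<Sum>j\<in>W. of_real (\<chi> j) * n j)"
    unfolding n_def
  proof (rule sum_fibres[OF finite_arcs fin(1) tW, where F = "\<lambda>\<alpha> x.
      ip U (?t \<alpha>) (C (?t \<alpha>) (?R' \<alpha> (?R \<alpha> x))) (C (?t \<alpha>) x)"])
    fix i y assume i: "i \<in> W" and y: "y \<in> E i"
    have iv: "i \<in> verts Q" and yV: "y \<in> vspace T i" using i y WB EV by blast+
    have "(\<Sum>\<alpha>\<in>out_arcs Q i. ip U i (C i (?R' \<alpha> (?R \<alpha> y))) (C i y))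
        = of_real (\<chi> i) * ip U i (C i y) (C i y)"
      using hrep_arc.amap_in[OF aT] hrep_arc.adj_in[OF aT] yV
      by (intro sum_ip_image[OF spT[OF iv] spU[OF iv] Clin[OF iv]] sumW i)
         (auto simp: out_arcs_def)
    then show "(\<Sum>\<alpha> | \<alpha> \<in> arcs Q \<and> ?t \<alpha> = i.
        ip U (?t \<alpha>) (C (?t \<alpha>) (?R' \<alpha> (?R \<alpha> y))) (C (?t \<alpha>) y))
        = of_real (\<chi> i) * ip U i (C i y) (C i y)"
      by (rule trans[rotated]) (auto simp: out_arcs_def intro!: sum.cong)
  qed
  \<comment> \<open>The vectors still come from the bases of \<open>T\<close>; the conditions of
    \<open>U\<close> are applied to their images under \<open>C\<close>. Equality of the characters
    makes the values the same as before.\<close>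
  have black': "(\<Sum>\<alpha>\<in>arcs Q. \<Sum>y\<in>E (?h \<alpha>).
      ip U (?h \<alpha>) (?S \<alpha> (?S' \<alpha> (C (?h \<alpha>) y))) (C (?h \<alpha>) y)) = P"
    unfolding P_def n_def
  proof (rule sum_fibres[OF finite_arcs fin(2) hB, where F = "\<lambda>\<alpha> y.
      ip U (?h \<alpha>) (?S \<alpha> (?S' \<alpha> (C (?h \<alpha>) y))) (C (?h \<alpha>) y)"])
    fix i y assume i: "i \<in> B" and y: "y \<in> E i"
    have iv: "i \<in> verts Q" and yV: "C i y \<in> vspace U i" using i y WB EV Cin by blast+
    have "(\<Sum>\<alpha>\<in>in_arcs Q i. ip U i (?S \<alpha> (?S' \<alpha> (C i y))) (C i y))
        = of_real (\<chi> i) * ip U i (C i y) (C i y)"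
      using hrep_arc.amap_in[OF aU] hrep_arc.adj_in[OF aU] yV
      by (intro sum_ip_image[OF spU[OF iv] spU[OF iv] linear_between_id] sumB' i)
         (auto simp: in_arcs_def)
    then show "(\<Sum>\<alpha> | \<alpha> \<in> arcs Q \<and> ?h \<alpha> = i.
        ip U (?h \<alpha>) (?S \<alpha> (?S' \<alpha> (C (?h \<alpha>) y))) (C (?h \<alpha>) y))
        = of_real (\<chi> i) * ip U i (C i y) (C i y)"
      by (rule trans[rotated]) (auto simp: in_arcs_def intro!: sum.cong)
  qed
  have white': "(\<Sum>\<alpha>\<in>arcs Q. \<Sum>x\<in>E (?t \<alpha>).
      ip U (?t \<alpha>) (?S' \<alpha> (?S \<alpha> (C (?t \<alpha>) x))) (C (?t \<alpha>) x)) = (\<Sum>j\<in>W. of_real (\<chi> j) * n j)"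
    unfolding n_def
  proof (rule sum_fibres[OF finite_arcs fin(1) tW, where F = "\<lambda>\<alpha> x.
      ip U (?t \<alpha>) (?S' \<alpha> (?S \<alpha> (C (?t \<alpha>) x))) (C (?t \<alpha>) x)"])
    fix i y assume i: "i \<in> W" and y: "y \<in> E i"
    have iv: "i \<in> verts Q" and yV: "C i y \<in> vspace U i" using i y WB EV Cin by blast+
    have "(\<Sum>\<alpha>\<in>out_arcs Q i. ip U i (?S' \<alpha> (?S \<alpha> (C i y))) (C i y))
        = of_real (\<chi> i) * ip U i (C i y) (C i y)"
      using hrep_arc.amap_in[OF aU] hrep_arc.adj_in[OF aU] yV
      by (intro sum_ip_image[OF spU[OF iv] spU[OF iv] linear_between_id] sumW' i)
         (auto simp: out_arcs_def)
    then show "(\<Sum>\<alpha> | \<alpha> \<in> arcs Q \<and> ?t \<alpha> = i.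
        ip U (?t \<alpha>) (?S' \<alpha> (?S \<alpha> (C (?t \<alpha>) y))) (C (?t \<alpha>) y))
        = of_real (\<chi> i) * ip U i (C i y) (C i y)"
      by (rule trans[rotated]) (auto simp: out_arcs_def intro!: sum.cong)
  qed

  \<comment> \<open>\<open>\<Sum>\<^sub>\<alpha> \<parallel>C T\<^sub>\<alpha>\<parallel>\<^sup>2 = \<Sum>\<^sub>\<alpha> \<parallel>U\<^sub>\<alpha> C\<parallel>\<^sup>2\<close>, evaluated on either side with one of the two conditions\<close>
  have WP: "(\<Sum>j\<in>W. of_real (\<chi> j) * n j) = P"
  proof -
    have "(\<Sum>x\<in>E (?t \<alpha>). ip U (?t \<alpha>) (?S' \<alpha> (?S \<alpha> (C (?t \<alpha>) x))) (C (?t \<alpha>) x))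
        = (\<Sum>y\<in>E (?h \<alpha>). ip U (?h \<alpha>) (C (?h \<alpha>) (?R \<alpha> (?R' \<alpha> y))) (C (?h \<alpha>) y))"
      if \<alpha>: "\<alpha> \<in> arcs Q" for \<alpha>
    proof -
      interpret T: hrep_arc Q T \<alpha> by (rule aT[OF \<alpha>])
      interpret U: hrep_arc Q U \<alpha> by (rule aU[OF \<alpha>])
      have v: "?t \<alpha> \<in> verts Q" "?h \<alpha> \<in> verts Q" using \<alpha> by auto
      \<comment> \<open>Moving \<open>?S' \<alpha>\<close> across the form and commuting
        \<open>C\<close> with the arrow maps turns each term into the squared norm of
        \<open>C (?h \<alpha>) (?R \<alpha> x)\<close>. The trace identity then passes to the basis
        at the head.\<close>
      have "(\<Sum>x\<in>E (?t \<alpha>). ip U (?t \<alpha>) (?S' \<alpha> (?S \<alpha> (C (?t \<alpha>) x))) (C (?t \<alpha>) x))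
          = (\<Sum>x\<in>E (?t \<alpha>). ip U (?h \<alpha>) (C (?h \<alpha>) (?R \<alpha> x)) (C (?h \<alpha>) (?R \<alpha> x)))"
        using EV v Cin by (intro sum.cong) (auto simp: U.adj_ip' U.amap_in Ccomm[OF \<alpha>])
      also have "\<dots> = (\<Sum>y\<in>E (?h \<alpha>). ip U (?h \<alpha>) (C (?h \<alpha>) (?R \<alpha> (?R' \<alpha> y))) (C (?h \<alpha>) y))"
        by (rule sum_norm_comp_adjoint[OF spT[OF v(1)] spT[OF v(2)] spU[OF v(2)] T.amap_linear
              T.adj_in T.adj_ip Clin[OF v(2)] E[OF v(1)] E[OF v(2)]])
      finally show ?thesis .
    qed
    then show ?thesis using black white' by simp
  qed
  \<comment> \<open>Sums of squared norms are real, so \<open>P\<close> is real and the two mutually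
    conjugate cross terms below contribute equally.\<close>
  have "cnj (n i) = n i" if i: "i \<in> verts Q" for i
    unfolding n_def cnj_sum
    using fd_inner_product.ip_cnj[OF spU[OF i]] Cin[OF i] EV[OF _ i]
    by (intro sum.cong refl) metis
  then have cnjP: "cnj P = P"
    unfolding P_def using WB(2) by (simp add: subset_iff)

  \<comment> \<open>\<open>z\<close> measures the failure of \<open>C\<close> to intertwine the
    adjoints, and \<open>N\<close> is its squared norm. \<open>aa\<close>, \<open>ab\<close> and
    \<open>bb\<close> are the terms in the expansion of \<open>N\<close>, the last two already moved
    to the head of the arrow.\<close>
  define z where "z \<alpha> y = C (?t \<alpha>) (?R' \<alpha> y) - ?S' \<alpha> (C (?h \<alpha>) y)" for \<alpha> y
  define N where "N \<alpha> y = ip U (?t \<alpha>) (z \<alpha> y) (z \<alpha> y)" for \<alpha> y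
  define aa where "aa \<alpha> y = ip U (?t \<alpha>) (C (?t \<alpha>) (?R' \<alpha> y)) (C (?t \<alpha>) (?R' \<alpha> y))" for \<alpha> y
  define ab where "ab \<alpha> y = ip U (?h \<alpha>) (C (?h \<alpha>) (?R \<alpha> (?R' \<alpha> y))) (C (?h \<alpha>) y)" for \<alpha> y
  define bb where "bb \<alpha> y = ip U (?h \<alpha>) (?S \<alpha> (?S' \<alpha> (C (?h \<alpha>) y))) (C (?h \<alpha>) y)" for \<alpha> y
  have zV: "z \<alpha> y \<in> vspace U (?t \<alpha>)" and Neq: "N \<alpha> y = aa \<alpha> y - ab \<alpha> y - cnj (ab \<alpha> y) + bb \<alpha> y"
    if \<alpha>: "\<alpha> \<in> arcs Q" and y: "y \<in> E (?h \<alpha>)" for \<alpha> y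
  proof -
    interpret T: hrep_arc Q T \<alpha> by (rule aT[OF \<alpha>])
    interpret U: hrep_arc Q U \<alpha> by (rule aU[OF \<alpha>])
    have v: "?t \<alpha> \<in> verts Q" "?h \<alpha> \<in> verts Q" using \<alpha> by auto
    have yV: "y \<in> vspace T (?h \<alpha>)" using EV y v by blast
    let ?a = "C (?t \<alpha>) (?R' \<alpha> y)" and ?w = "C (?h \<alpha>) y"
    have a: "?a \<in> vspace U (?t \<alpha>)" using Cin[OF v(1)] T.adj_in[OF yV] by blast
    have w: "?w \<in> vspace U (?h \<alpha>)" using Cin[OF v(2)] yV by blast
    have b: "?S' \<alpha> ?w \<in> vspace U (?t \<alpha>)" using U.adj_in[OF w] .
    show "z \<alpha> y \<in> vspace U (?t \<alpha>)"
      unfolding z_def using a b U.t.sub by (intro U.t.subspace_diff)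
    have 1: "ip U (?t \<alpha>) ?a (?S' \<alpha> ?w) = ab \<alpha> y"
      unfolding ab_def Ccomm[OF \<alpha> T.adj_in[OF yV]] using U.adj_ip[OF w a] by simp
    have 2: "ip U (?t \<alpha>) (?S' \<alpha> ?w) ?a = cnj (ab \<alpha> y)"
      using U.t.ip_cnj[OF a b] 1 by simp
    have 3: "ip U (?t \<alpha>) (?S' \<alpha> ?w) (?S' \<alpha> ?w) = bb \<alpha> y"
      unfolding bb_def using U.adj_ip[OF w b] by simp
    show "N \<alpha> y = aa \<alpha> y - ab \<alpha> y - cnj (ab \<alpha> y) + bb \<alpha> y"
      unfolding N_def z_def aa_def using a b U.t.sub 1 2 3
      by (simp add: U.t.ip_diff U.t.ip_diff_right U.t.subspace_diff)
  qed
  \<comment> \<open>The roles are exchanged here: the trace identity is applied to the adjoint,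
    whose own adjoint is the arrow map, so the sum moves from the head basis to the tail
    basis.\<close>
  have aa: "(\<Sum>\<alpha>\<in>arcs Q. \<Sum>y\<in>E (?h \<alpha>). aa \<alpha> y) = P"
  proof -
    have "(\<Sum>y\<in>E (?h \<alpha>). aa \<alpha> y)
        = (\<Sum>x\<in>E (?t \<alpha>). ip U (?t \<alpha>) (C (?t \<alpha>) (?R' \<alpha> (?R \<alpha> x))) (C (?t \<alpha>) x))"
      if \<alpha>: "\<alpha> \<in> arcs Q" for \<alpha>
    proof -
      interpret T: hrep_arc Q T \<alpha> by (rule aT[OF \<alpha>])
      have v: "?t \<alpha> \<in> verts Q" "?h \<alpha> \<in> verts Q" using \<alpha> by auto
      show ?thesis
        unfolding aa_def
        by (rule sum_norm_comp_adjoint[OF spT[OF v(2)] spT[OF v(1)] spU[OF v(1)] T.adj_linear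
              T.amap_in T.adj_ip' Clin[OF v(1)] E[OF v(2)] E[OF v(1)]])
    qed
    then show ?thesis using white WP by simp
  qed
  have "(\<Sum>\<alpha>\<in>arcs Q. \<Sum>y\<in>E (?h \<alpha>). N \<alpha> y)
      = (\<Sum>\<alpha>\<in>arcs Q. \<Sum>y\<in>E (?h \<alpha>). aa \<alpha> y - ab \<alpha> y - cnj (ab \<alpha> y) + bb \<alpha> y)"
    by (intro sum.cong refl Neq)
  also have "\<dots> = (\<Sum>\<alpha>\<in>arcs Q. \<Sum>y\<in>E (?h \<alpha>). aa \<alpha> y) - (\<Sum>\<alpha>\<in>arcs Q. \<Sum>y\<in>E (?h \<alpha>). ab \<alpha> y)
      - cnj (\<Sum>\<alpha>\<in>arcs Q. \<Sum>y\<in>E (?h \<alpha>). ab \<alpha> y) + (\<Sum>\<alpha>\<in>arcs Q. \<Sum>y\<in>E (?h \<alpha>). bb \<alpha> y)"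
    by (simp add: sum.distrib sum_subtractf)
  \<comment> \<open>The four sums give \<open>P - P - cnj P + P\<close>, and \<open>P\<close> is
    real.\<close>
  also have "\<dots> = 0"
    using aa black black' cnjP unfolding ab_def bb_def by simp
  finally have "Re (\<Sum>\<alpha>\<in>arcs Q. \<Sum>y\<in>E (?h \<alpha>). N \<alpha> y) = 0"
    by simp
  then have "(\<Sum>\<alpha>\<in>arcs Q. \<Sum>y\<in>E (?h \<alpha>). Re (N \<alpha> y)) = 0"
    by simp
  moreover have N0: "0 \<le> Re (N \<alpha> y)" and Nz: "Re (N \<alpha> y) = 0 \<Longrightarrow> z \<alpha> y = 0"
    if "\<alpha> \<in> arcs Q" "y \<in> E (?h \<alpha>)" for \<alpha> y
  proof -
    interpret U: hrep_arc Q U \<alpha> by (rule aU[OF that(1)])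
    show "0 \<le> Re (N \<alpha> y)" "Re (N \<alpha> y) = 0 \<Longrightarrow> z \<alpha> y = 0"
      using U.t.ip_pos[OF zV[OF that]] U.t.ip_zero[OF U.t.subspace_0[OF U.t.sub]]
      unfolding N_def by (cases "z \<alpha> y = 0"; force)+
  qed
  ultimately have "\<forall>\<alpha>\<in>arcs Q. (\<Sum>y\<in>E (?h \<alpha>). Re (N \<alpha> y)) = 0"
    by (subst (asm) sum_nonneg_eq_0_iff) (auto intro!: sum_nonneg)
  then have Re0: "Re (N \<alpha> y) = 0" if "\<alpha> \<in> arcs Q" "y \<in> E (?h \<alpha>)" for \<alpha> y
    using that N0 fd_inner_product.orthonormal_basisD(1)[OF spT E, of "?h \<alpha>"]
      sum_nonneg_eq_0_iff[of "E (?h \<alpha>)" "\<lambda>y. Re (N \<alpha> y)"] by auto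
  have "C (?t \<alpha>) (?R' \<alpha> y) = ?S' \<alpha> (C (?h \<alpha>) y)"
    if \<alpha>: "\<alpha> \<in> arcs Q" and y: "y \<in> vspace T (?h \<alpha>)" for \<alpha> y
  proof -
    interpret T: hrep_arc Q T \<alpha> by (rule aT[OF \<alpha>])
    interpret U: hrep_arc Q U \<alpha> by (rule aU[OF \<alpha>])
    have v: "?t \<alpha> \<in> verts Q" "?h \<alpha> \<in> verts Q" using \<alpha> by auto
    have vs: "vector_space (scl U)" by unfold_locales
    have EV': "e \<in> vspace T (?h \<alpha>)" if "e \<in> E (?h \<alpha>)" for e using EV that v by blast
    have eq: "C (?t \<alpha>) (?R' \<alpha> e) = ?S' \<alpha> (C (?h \<alpha>) e)" if "e \<in> E (?h \<alpha>)" for e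
      using Nz[OF \<alpha> that Re0[OF \<alpha> that]] unfolding z_def by simp
    \<comment> \<open>Expanding \<open>y\<close> in the basis at the head extends the identity from
      basis vectors to the whole space; the fact is instantiated below for both composites.\<close>
    note sum = T.t.linear_between_sum[OF _ T.h.sub vs, where E = "E (?h \<alpha>)" and x = "\<lambda>e. e"
        and c = "\<lambda>e. ip T (?h \<alpha>) y e", OF _ EV',
        unfolded fd_inner_product.orthonormal_basisD(3)[OF spT[OF v(2)] E[OF v(2)] y]]
    show ?thesis
      using sum[OF linear_between_comp[OF T.adj_linear Clin[OF v(1)]]]
        sum[OF linear_between_comp[OF Clin[OF v(2)] U.adj_linear]] eq
      by simp
  qed
  then show ?thesis using C unfolding HRepHom_def by blast
qed

section \<open>Decomposition along reducing subrepresentations\<close>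

text \<open>The preceding lemma applies to an isomorphism and to its inverse, so both already lie in
  the Hilbert space category.\<close>

lemma rep_equiv_imp_osrep_equiv:
  assumes "fin_digraph Q" "separated Q W B"
    and "orthoscalar Q W B \<chi> T" "orthoscalar Q W B \<chi> U" and "rep_equiv Q T U"
  shows "osrep_equiv Q W B T U"
  using assms RepHom_orthoscalar unfolding rep_equiv_def osrep_equiv_def is_osrep_def by metis

text \<open>The inverse of a vertexwise bijective morphism is again linear and commutes with the
  arrows. The conclusion runs from \<open>U\<close> to \<open>T\<close>, the direction wanted for
  decompositions.\<close>

lemma rep_equivI:
  assumes T: "is_rep Q T" and U: "is_rep Q U" and "fin_digraph Q" and C: "C \<in> RepHom Q T U"
    and bij: "\<And>i. i \<in> verts Q \<Longrightarrow> bij_betw (C i) (vspace T i) (vspace U i)"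
  shows "rep_equiv Q U T"
proof -
  interpret fin_digraph Q by fact
  interpret complex_vector_space "scl T"
    using T by (simp add: is_rep_def complex_vector_space_def)
  define D where "D = (\<lambda>i\<in>verts Q. \<lambda>y\<in>vspace U i. the_inv_into (vspace T i) (C i) y)"
  have sub: "subspace (vspace T i)" if "i \<in> verts Q" for i
    using T that unfolding is_rep_def findim_subspace_def by blast
  have CD: "C i (D i y) = y" and D_in: "D i y \<in> vspace T i"
    if "i \<in> verts Q" "y \<in> vspace U i" for i y
    using bij_betw_the_inv_into[OF bij[OF that(1)]] that bij[OF that(1)]
    by (auto simp: D_def f_the_inv_into_f_bij_betw dest: bij_betwE)
  have DC: "D i (C i x) = x" if "i \<in> verts Q" "x \<in> vspace T i" for i x
    using bij[OF that(1)] that by (auto simp: D_def bij_betw_def the_inv_into_f_f)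
  note Clin = RepHom_linear[OF C]
  \<comment> \<open>To evaluate \<open>D\<close> it is enough to exhibit a preimage under
    \<open>C\<close>; additivity, homogeneity and commutation are all reduced to this.\<close>
  have DI: "D i y = x" if "i \<in> verts Q" "x \<in> vspace T i" "C i x = y" for i x y
    using DC that by blast
  have "D \<in> RepHom Q U T"
    unfolding RepHom_def
  proof (intro CollectI conjI ballI)
    show "D \<in> extensional (verts Q)" by (simp add: D_def)
  next
    fix i assume i: "i \<in> verts Q"
    then show "D i \<in> extensional (vspace U i)" by (simp add: D_def)
    show "linear_between (scl U) (vspace U i) (scl T) (vspace T i) (D i)"
      unfolding linear_between_def
    proof (intro conjI ballI allI)
      fix x y assume "x \<in> vspace U i" "y \<in> vspace U i"
      then show "D i (x + y) = D i x + D i y"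
        using Clin[OF i] i sub[OF i] unfolding linear_between_def
        by (intro DI) (auto simp: CD D_in subspace_add)
    next
      fix c x assume "x \<in> vspace U i"
      then show "D i (scl U c x) = scl T c (D i x)"
        using Clin[OF i] i sub[OF i] unfolding linear_between_def
        by (intro DI) (auto simp: CD D_in subspace_scale)
    qed (simp add: D_in i)
  next
    fix \<alpha> x assume a: "\<alpha> \<in> arcs Q" "x \<in> vspace U (tail Q \<alpha>)"
    then have v: "tail Q \<alpha> \<in> verts Q" "head Q \<alpha> \<in> verts Q" by auto
    show "D (head Q \<alpha>) (amap U \<alpha> x) = amap T \<alpha> (D (tail Q \<alpha>) x)"
      using a v linear_between_in[OF is_rep_amap[OF T a(1)]]
      by (intro DI) (simp_all add: D_in CD RepHom_commute[OF C])
  qed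
  moreover have "comp_mor Q T D C = id_mor Q T"
    by (auto simp: comp_mor_def id_mor_def DC fun_eq_iff restrict_def)
  moreover have "comp_mor Q U C D = id_mor Q U"
    by (auto simp: comp_mor_def id_mor_def CD fun_eq_iff restrict_def)
  ultimately show "rep_equiv Q U T"
    using T U C unfolding rep_equiv_def by blast
qed

section \<open>Direct sums\<close>

lemma vector_space_Times:
  assumes "vector_space s" "vector_space s'"
  shows "vector_space (\<lambda>c (x, y). (s c x, s' c y))"
proof -
  interpret s: vector_space s by fact
  interpret s': vector_space s' by fact
  show ?thesis
    by unfold_locales (auto simp: s.scale_right_distrib s.scale_left_distrib
        s'.scale_right_distrib s'.scale_left_distrib)
qed

text \<open>The images of the two spanning sets under the coordinate inclusions together span the
  product.\<close>

lemma findim_subspace_Times: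
  assumes "vector_space s" "vector_space s'" "findim_subspace s V" "findim_subspace s' V'"
  shows "findim_subspace (\<lambda>c (x, y). (s c x, s' c y)) (V \<times> V')"
proof -
  interpret s: vector_space s by fact
  interpret s': vector_space s' by fact
  interpret p: vector_space "\<lambda>c (x, y). (s c x, s' c y)"
    by (rule vector_space_Times) fact+
  obtain A A' where A: "finite A" "V = s.span A" and A': "finite A'" "V' = s'.span A'"
    using assms(3,4) unfolding findim_subspace_def by blast
  have sub: "s.subspace V" "s'.subspace V'" using A A' by simp_all
  have psub: "p.subspace (V \<times> V')"
    using sub by (auto simp: p.subspace_def s.subspace_def s'.subspace_def zero_prod_def)
  let ?E = "(\<lambda>a. (a, 0)) ` A \<union> (\<lambda>a. (0, a)) ` A'"
  have fst: "(x, 0) \<in> p.span ?E" if "x \<in> s.span A" for x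
    using that
  proof (induction rule: s.span_induct_alt)
    case base
    then show ?case using p.span_zero by (simp add: zero_prod_def)
  next
    case (step c x y)
    have "(x, 0) \<in> p.span ?E" using step by (intro p.span_base) blast
    from p.span_add[OF p.span_scale[OF this, of c] step(2)] show ?case by simp
  qed
  have snd: "(0, x) \<in> p.span ?E" if "x \<in> s'.span A'" for x
    using that
  proof (induction rule: s'.span_induct_alt)
    case base
    then show ?case using p.span_zero by (simp add: zero_prod_def)
  next
    case (step c x y)
    have "(0, x) \<in> p.span ?E" using step by (intro p.span_base) blast
    from p.span_add[OF p.span_scale[OF this, of c] step(2)] show ?case by simp
  qed
  have "V \<times> V' \<subseteq> p.span ?E"
  proof clarify
    fix x y assume "x \<in> V" "y \<in> V'"
    then show "(x, y) \<in> p.span ?E"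
      using p.span_add[OF fst snd, of x y] A A' by simp
  qed
  moreover have "p.span ?E \<subseteq> V \<times> V'"
    using A A' sub s.span_superset s'.span_superset s.subspace_0 s'.subspace_0
    by (intro p.span_minimal psub) auto
  ultimately show ?thesis
    using psub A(1) A'(1) unfolding findim_subspace_def by (intro conjI exI[of _ ?E]) auto
qed

lemma hrep_dsum_simps:
  "scl (hrep_dsum U V) = (\<lambda>c (x, y). (scl U c x, scl V c y))"
  "vspace (hrep_dsum U V) = (\<lambda>i. vspace U i \<times> vspace V i)"
  "amap (hrep_dsum U V) = (\<lambda>\<alpha> (x, y). (amap U \<alpha> x, amap V \<alpha> y))"
  "ip (hrep_dsum U V) = (\<lambda>i (x, y) (x', y'). ip U i x x' + ip V i y y')"
  by (simp_all add: hrep_dsum_def rep_dsum_def rep.extend_def hrep.fields_def)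

lemma is_hrep_dsum:
  assumes "is_hrep Q U" "is_hrep Q V"
  shows "is_hrep Q (hrep_dsum U V)"
proof -
  have vs: "vector_space (scl U)" "vector_space (scl V)"
    using assms unfolding is_hrep_def is_rep_def by blast+
  have "is_rep Q (hrep_dsum U V)"
    using assms unfolding is_hrep_def is_rep_def hrep_dsum_simps
    by (auto intro!: vector_space_Times findim_subspace_Times simp: linear_between_def)
  moreover have "inner_product_on (scl (hrep_dsum U V)) (vspace (hrep_dsum U V) i) (ip (hrep_dsum U V) i)"
    if i: "i \<in> verts Q" for i
  proof -
    interpret U: fd_inner_product "scl U" "vspace U i" "ip U i" by (rule is_hrep_space[OF assms(1) i])
    interpret V: fd_inner_product "scl V" "vspace V i" "ip V i" by (rule is_hrep_space[OF assms(2) i])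
    \<comment> \<open>Nonnegativity must cover the zero vector too, since a nonzero pair may have
      one zero component.\<close>
    have pU: "ip U i x x \<in> \<real> \<and> 0 \<le> Re (ip U i x x)" if "x \<in> vspace U i" for x
      using U.ip_pos[OF that] U.ip_zero[OF that] by (cases "x = 0") auto
    have pV: "ip V i x x \<in> \<real> \<and> 0 \<le> Re (ip V i x x)" if "x \<in> vspace V i" for x
      using V.ip_pos[OF that] V.ip_zero[OF that] by (cases "x = 0") auto
    have pos: "ip U i x x + ip V i y y \<in> \<real> \<and> 0 < Re (ip U i x x + ip V i y y)"
      if "x \<in> vspace U i" "y \<in> vspace V i" "(x, y) \<noteq> 0" for x y
    proof -
      have "0 < Re (ip U i x x) \<or> 0 < Re (ip V i y y)"
        using that U.ip_pos V.ip_pos by (auto simp: zero_prod_def)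
      then show ?thesis
        using pU[OF that(1)] pV[OF that(2)] by auto
    qed
    have sym: "ip U i x' x + ip V i y' y = cnj (ip U i x x' + ip V i y y')"
      if "x \<in> vspace U i" "x' \<in> vspace U i" "y \<in> vspace V i" "y' \<in> vspace V i" for x x' y y'
      using U.ip_cnj[OF that(1,2)] V.ip_cnj[OF that(3,4)] by simp
    show ?thesis
      unfolding inner_product_on_def hrep_dsum_simps
    proof (intro conjI ballI allI impI)
      fix x y z
      assume "x \<in> vspace U i \<times> vspace V i" "y \<in> vspace U i \<times> vspace V i"
        "z \<in> vspace U i \<times> vspace V i"
      then show "(case x + y of (x, y) \<Rightarrow> \<lambda>(x', y'). ip U i x x' + ip V i y y') z
          = (case x of (x, y) \<Rightarrow> \<lambda>(x', y'). ip U i x x' + ip V i y y') z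
          + (case y of (x, y) \<Rightarrow> \<lambda>(x', y'). ip U i x x' + ip V i y y') z"
        by (auto simp: U.ip_add V.ip_add)
    next
      fix c x y
      assume "x \<in> vspace U i \<times> vspace V i" "y \<in> vspace U i \<times> vspace V i"
      then show "(case (case x of (x, y) \<Rightarrow> (scl U c x, scl V c y)) of
            (x, y) \<Rightarrow> \<lambda>(x', y'). ip U i x x' + ip V i y y') y
          = c * (case x of (x, y) \<Rightarrow> \<lambda>(x', y'). ip U i x x' + ip V i y y') y"
        by (auto simp: U.ip_scale V.ip_scale distrib_left)
    next
      fix x y
      assume "x \<in> vspace U i \<times> vspace V i" "y \<in> vspace U i \<times> vspace V i"
      then show "(case y of (x, y) \<Rightarrow> \<lambda>(x', y'). ip U i x x' + ip V i y y') x
          = cnj ((case x of (x, y) \<Rightarrow> \<lambda>(x', y'). ip U i x x' + ip V i y y') y)"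
        using sym[of "fst x" "fst y" "snd x" "snd y"] by (simp add: mem_Times_iff split_beta)
    next
      fix x assume "x \<in> vspace U i \<times> vspace V i" "x \<noteq> 0"
      then show "(case x of (x, y) \<Rightarrow> \<lambda>(x', y'). ip U i x x' + ip V i y y') x \<in> \<real>"
        "0 < Re ((case x of (x, y) \<Rightarrow> \<lambda>(x', y'). ip U i x x' + ip V i y y') x)"
        using pos[of "fst x" "snd x"] by (simp_all add: mem_Times_iff split_beta)
    qed
  qed
  ultimately show ?thesis unfolding is_hrep_def by blast
qed

text \<open>By uniqueness the adjoint acts componentwise on the sum, so the conditions for a common
  character split into those of the summands.\<close>

lemma orthoscalar_dsum:
  fixes Q :: "('v, 'e) pre_digraph" and U :: "('v, 'e, 'a::ab_group_add) hrep"
    and V :: "('v, 'e, 'b::ab_group_add) hrep"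
  assumes "wf_digraph Q" and U: "orthoscalar Q W B \<chi> U" and V: "orthoscalar Q W B \<chi> V"
  shows "orthoscalar Q W B \<chi> (hrep_dsum U V)"
proof -
  have h: "is_hrep Q U" "is_hrep Q V" using U V unfolding orthoscalar_def by blast+
  note hd = is_hrep_dsum[OF h]
  have adj: "adj Q (hrep_dsum U V) \<alpha> (x, y) = (adj Q U \<alpha> x, adj Q V \<alpha> y)"
    if "\<alpha> \<in> arcs Q" "x \<in> vspace U (head Q \<alpha>)" "y \<in> vspace V (head Q \<alpha>)" for \<alpha> x y
  proof -
    interpret U: hrep_arc Q U \<alpha> by (rule hrep_arcI[OF assms(1) h(1) that(1)])
    interpret V: hrep_arc Q V \<alpha> by (rule hrep_arcI[OF assms(1) h(2) that(1)])
    interpret D: hrep_arc Q "hrep_dsum U V" \<alpha> by (rule hrep_arcI[OF assms(1) hd that(1)])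
    show ?thesis
      using that by (intro D.adj_unique) (auto simp: hrep_dsum_simps U.adj_in V.adj_in U.adj_ip V.adj_ip)
  qed
  have sum_prod: "(\<Sum>\<alpha>\<in>I. (f \<alpha>, g \<alpha>)) = (\<Sum>\<alpha>\<in>I. f \<alpha>, \<Sum>\<alpha>\<in>I. g \<alpha>)"
    for I :: "'e set" and f :: "'e \<Rightarrow> 'a" and g :: "'e \<Rightarrow> 'b"
    by (simp add: prod_eq_iff fst_sum snd_sum)
  have black: "(\<Sum>\<alpha>\<in>in_arcs Q i. amap (hrep_dsum U V) \<alpha> (adj Q (hrep_dsum U V) \<alpha> (x, y)))
      = scl (hrep_dsum U V) (of_real (\<chi> i)) (x, y)"
    if i: "i \<in> B" "x \<in> vspace U i" "y \<in> vspace V i" for i x y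
  proof -
    have "(\<Sum>\<alpha>\<in>in_arcs Q i. amap (hrep_dsum U V) \<alpha> (adj Q (hrep_dsum U V) \<alpha> (x, y)))
        = (\<Sum>\<alpha>\<in>in_arcs Q i. (amap U \<alpha> (adj Q U \<alpha> x), amap V \<alpha> (adj Q V \<alpha> y)))"
      using i by (intro sum.cong) (auto simp: in_arcs_def adj hrep_dsum_simps(3))
    then show ?thesis
      using U V i by (simp add: sum_prod orthoscalar_def hrep_dsum_simps(1))
  qed
  have white: "(\<Sum>\<alpha>\<in>out_arcs Q i. adj Q (hrep_dsum U V) \<alpha> (amap (hrep_dsum U V) \<alpha> (x, y)))
      = scl (hrep_dsum U V) (of_real (\<chi> i)) (x, y)"
    if i: "i \<in> W" "x \<in> vspace U i" "y \<in> vspace V i" for i x y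
  proof -
    have "(\<Sum>\<alpha>\<in>out_arcs Q i. adj Q (hrep_dsum U V) \<alpha> (amap (hrep_dsum U V) \<alpha> (x, y)))
        = (\<Sum>\<alpha>\<in>out_arcs Q i. (adj Q U \<alpha> (amap U \<alpha> x), adj Q V \<alpha> (amap V \<alpha> y)))"
      using i hrep_arc.amap_in[OF hrep_arcI[OF assms(1) h(1)]]
        hrep_arc.amap_in[OF hrep_arcI[OF assms(1) h(2)]]
      by (intro sum.cong) (auto simp: out_arcs_def adj hrep_dsum_simps(3))
    then show ?thesis
      using U V i by (simp add: sum_prod orthoscalar_def hrep_dsum_simps(1))
  qed
  have "\<forall>i\<in>verts Q. 0 \<le> \<chi> i" using U unfolding orthoscalar_def by blast
  then show ?thesis
    using hd black white unfolding orthoscalar_def by (auto simp: hrep_dsum_simps(2))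
qed

section \<open>Reducing subrepresentations and their complements\<close>

text \<open>Invariance under the adjoints as well as the maps is what makes such a family an
  orthogonal direct summand.\<close>

definition reducing ::
  "('v, 'e) pre_digraph \<Rightarrow> ('v, 'e, 'a::ab_group_add) hrep \<Rightarrow> ('v \<Rightarrow> 'a set) \<Rightarrow> bool" where
  "reducing Q T K \<longleftrightarrow>
     (\<forall>i\<in>verts Q. module.subspace (scl T) (K i) \<and> K i \<subseteq> vspace T i) \<and>
     (\<forall>\<alpha>\<in>arcs Q. (\<forall>x\<in>K (tail Q \<alpha>). amap T \<alpha> x \<in> K (head Q \<alpha>)) \<and>
                  (\<forall>y\<in>K (head Q \<alpha>). adj Q T \<alpha> y \<in> K (tail Q \<alpha>)))"

text \<open>Since \<open>K\<close> is invariant under adjoints, the adjoint of a restricted map is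
  the restriction of the adjoint, and the equations simply restrict.\<close>

lemma orthoscalar_restrict:
  assumes "wf_digraph Q" "separated Q W B" and T: "orthoscalar Q W B \<chi> T" and K: "reducing Q T K"
  shows "orthoscalar Q W B \<chi> (T\<lparr>vspace := K\<rparr>)"
proof -
  let ?U = "T\<lparr>vspace := K\<rparr>"
  interpret wf_digraph Q by fact
  have h: "is_hrep Q T" using T unfolding orthoscalar_def by blast
  interpret complex_vector_space "scl T"
    using h by (simp add: is_hrep_def is_rep_def complex_vector_space_def)
  have KV: "subspace (K i)" "K i \<subseteq> vspace T i" if "i \<in> verts Q" for i
    using K that unfolding reducing_def by blast+
  have Kinv: "\<And>x. x \<in> K (tail Q \<alpha>) \<Longrightarrow> amap T \<alpha> x \<in> K (head Q \<alpha>)"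
    "\<And>y. y \<in> K (head Q \<alpha>) \<Longrightarrow> adj Q T \<alpha> y \<in> K (tail Q \<alpha>)" if "\<alpha> \<in> arcs Q" for \<alpha>
    using K that unfolding reducing_def by blast+
  have "is_hrep Q ?U"
    unfolding is_hrep_def is_rep_def
  proof (intro conjI ballI)
    show "vector_space (scl ?U)" by simp unfold_locales
  next
    fix i assume i: "i \<in> verts Q"
    show "findim_subspace (scl ?U) (vspace ?U i)"
      using findim_subspace_subset[OF _ KV[OF i]] h i unfolding is_hrep_def is_rep_def by simp
    show "inner_product_on (scl ?U) (vspace ?U i) (ip ?U i)"
      using inner_product_on_subset[OF fd_inner_product.inner[OF is_hrep_space[OF h i]] KV(2)[OF i]]
      by simp
  next
    fix \<alpha> assume a: "\<alpha> \<in> arcs Q"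
    then have "tail Q \<alpha> \<in> verts Q" by simp
    then show "linear_between (scl ?U) (vspace ?U (tail Q \<alpha>)) (scl ?U) (vspace ?U (head Q \<alpha>)) (amap ?U \<alpha>)"
      using KV(2) Kinv[OF a] hrep_arc.amap_linear[OF hrep_arcI[OF assms(1) h a]]
      by (simp add: linear_between_def subset_iff)
  qed
  note hU = this
  have adj: "adj Q ?U \<alpha> y = adj Q T \<alpha> y" if a: "\<alpha> \<in> arcs Q" and y: "y \<in> K (head Q \<alpha>)" for \<alpha> y
  proof -
    interpret U: hrep_arc Q ?U \<alpha> by (rule hrep_arcI[OF assms(1) hU a])
    have "tail Q \<alpha> \<in> verts Q" "head Q \<alpha> \<in> verts Q" using a by auto
    then show ?thesis
      using KV(2) Kinv[OF a] y hrep_arc.adj_ip[OF hrep_arcI[OF assms(1) h a]]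
      by (intro U.adj_unique) (simp_all add: subset_iff)
  qed
  have WB: "W \<subseteq> verts Q" "B \<subseteq> verts Q" using assms(2) unfolding separated_def by auto
  have "(\<Sum>\<alpha>\<in>in_arcs Q i. amap ?U \<alpha> (adj Q ?U \<alpha> x)) = scl ?U (of_real (\<chi> i)) x"
    if i: "i \<in> B" "x \<in> K i" for i x
  proof -
    have "(\<Sum>\<alpha>\<in>in_arcs Q i. amap ?U \<alpha> (adj Q ?U \<alpha> x)) = (\<Sum>\<alpha>\<in>in_arcs Q i. amap T \<alpha> (adj Q T \<alpha> x))"
      using i by (intro sum.cong) (auto simp: in_arcs_def adj)
    moreover have "x \<in> vspace T i" using i WB KV(2) by blast
    ultimately show ?thesis using T i(1) unfolding orthoscalar_def by simp
  qed
  moreover have "(\<Sum>\<alpha>\<in>out_arcs Q i. adj Q ?U \<alpha> (amap ?U \<alpha> x)) = scl ?U (of_real (\<chi> i)) x"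
    if i: "i \<in> W" "x \<in> K i" for i x
  proof -
    have "(\<Sum>\<alpha>\<in>out_arcs Q i. adj Q ?U \<alpha> (amap ?U \<alpha> x)) = (\<Sum>\<alpha>\<in>out_arcs Q i. adj Q T \<alpha> (amap T \<alpha> x))"
      using i by (intro sum.cong) (auto simp: out_arcs_def adj Kinv)
    moreover have "x \<in> vspace T i" using i WB KV(2) by blast
    ultimately show ?thesis using T i(1) unfolding orthoscalar_def by simp
  qed
  ultimately show ?thesis
    using T hU unfolding orthoscalar_def by simp
qed

definition orthogonal_complement ::
  "('v, 'e, 'a::ab_group_add) hrep \<Rightarrow> ('v \<Rightarrow> 'a set) \<Rightarrow> 'v \<Rightarrow> 'a set" where
  "orthogonal_complement T K i = {x \<in> vspace T i. \<forall>k\<in>K i. ip T i x k = 0}"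

text \<open>Maps and adjoints trade places: invariance of \<open>K\<close> under one gives
  invariance of the complement under the other.\<close>

lemma reducing_orthogonal_complement:
  assumes "wf_digraph Q" and h: "is_hrep Q T" and K: "reducing Q T K"
  shows "reducing Q T (orthogonal_complement T K)"
  unfolding reducing_def
proof (intro conjI ballI)
  fix i assume i: "i \<in> verts Q"
  interpret fd_inner_product "scl T" "vspace T i" "ip T i" by (rule is_hrep_space[OF h i])
  have KV: "K i \<subseteq> vspace T i" using K i unfolding reducing_def by blast
  show "subspace (orthogonal_complement T K i)"
    unfolding subspace_def orthogonal_complement_def using KV sub
    by (auto simp: ip_zero ip_add ip_scale subset_iff subspace_0 subspace_add subspace_scale)
  show "orthogonal_complement T K i \<subseteq> vspace T i"
    unfolding orthogonal_complement_def by blast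
next
  interpret wf_digraph Q by fact
  fix \<alpha> assume a: "\<alpha> \<in> arcs Q"
  interpret hrep_arc Q T \<alpha> by (rule hrep_arcI[OF assms(1) h a])
  have KV: "K (tail Q \<alpha>) \<subseteq> vspace T (tail Q \<alpha>)" "K (head Q \<alpha>) \<subseteq> vspace T (head Q \<alpha>)"
    using K a unfolding reducing_def by simp_all
  have Kinv: "\<And>x. x \<in> K (tail Q \<alpha>) \<Longrightarrow> amap T \<alpha> x \<in> K (head Q \<alpha>)"
    "\<And>y. y \<in> K (head Q \<alpha>) \<Longrightarrow> adj Q T \<alpha> y \<in> K (tail Q \<alpha>)"
    using K a unfolding reducing_def by blast+
  {
    fix x assume "x \<in> orthogonal_complement T K (tail Q \<alpha>)"
    then show "amap T \<alpha> x \<in> orthogonal_complement T K (head Q \<alpha>)"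
      using KV Kinv by (auto simp: orthogonal_complement_def amap_in adj_ip subset_iff)
  next
    fix y assume "y \<in> orthogonal_complement T K (head Q \<alpha>)"
    then show "adj Q T \<alpha> y \<in> orthogonal_complement T K (tail Q \<alpha>)"
      using KV Kinv by (auto simp: orthogonal_complement_def adj_in adj_ip' subset_iff)
  }
qed

text \<open>It suffices to find an isomorphism of plain representations: \<open>T\<close> and the
  sum are orthoscalar with the same character, so compatibility with the adjoints follows from the
  result on equivalences.\<close>

lemma reducing_decomposition:
  assumes "fin_digraph Q" and sep: "separated Q W B" and T: "orthoscalar Q W B \<chi> T"
    and K: "reducing Q T K"
  defines "U \<equiv> T\<lparr>vspace := K\<rparr>" and "V \<equiv> T\<lparr>vspace := orthogonal_complement T K\<rparr>"
  shows "orthoscalar Q W B \<chi> U" "orthoscalar Q W B \<chi> V" "osrep_equiv Q W B T (hrep_dsum U V)"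
proof -
  interpret fin_digraph Q by fact
  have wf: "wf_digraph Q" by unfold_locales
  have h: "is_hrep Q T" using T unfolding orthoscalar_def by blast
  have K': "reducing Q T (orthogonal_complement T K)"
    by (rule reducing_orthogonal_complement[OF wf h K])
  show U: "orthoscalar Q W B \<chi> U" and V: "orthoscalar Q W B \<chi> V"
    unfolding U_def V_def by (rule orthoscalar_restrict[OF wf sep T] K K')+
  have D: "orthoscalar Q W B \<chi> (hrep_dsum U V)" by (rule orthoscalar_dsum[OF wf U V])
  let ?K' = "orthogonal_complement T K"
  \<comment> \<open>Addition is the isomorphism. It is injective because a vector of
    \<open>K i\<close> orthogonal to \<open>K i\<close> is zero, and surjective by orthogonal
    projection.\<close>
  define C where "C = (\<lambda>i\<in>verts Q. \<lambda>z\<in>K i \<times> ?K' i. fst z + snd z)"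
  have KV: "K i \<subseteq> vspace T i" "?K' i \<subseteq> vspace T i" if "i \<in> verts Q" for i
    using K K' that unfolding reducing_def by blast+
  have Ksub: "module.subspace (scl T) (K i)" "module.subspace (scl T) (?K' i)" if "i \<in> verts Q" for i
    using K K' that unfolding reducing_def by blast+
  have "C \<in> RepHom Q (hrep_dsum U V) T"
    unfolding RepHom_def
  proof (intro CollectI conjI ballI)
    fix i assume i: "i \<in> verts Q"
    interpret fd_inner_product "scl T" "vspace T i" "ip T i" by (rule is_hrep_space[OF h i])
    show "C i \<in> extensional (vspace (hrep_dsum U V) i)"
      using i by (simp add: C_def hrep_dsum_simps U_def V_def)
    show "linear_between (scl (hrep_dsum U V)) (vspace (hrep_dsum U V) i) (scl T) (vspace T i) (C i)"
      using i KV[OF i] sub subspace_add[OF Ksub(1)[OF i]] subspace_add[OF Ksub(2)[OF i]]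
        subspace_scale[OF Ksub(1)[OF i]] subspace_scale[OF Ksub(2)[OF i]]
      by (auto simp: C_def hrep_dsum_simps U_def V_def linear_between_def scale_right_distrib
          subset_iff intro: subspace_add)
  next
    fix \<alpha> z assume a: "\<alpha> \<in> arcs Q" and z: "z \<in> vspace (hrep_dsum U V) (tail Q \<alpha>)"
    interpret hrep_arc Q T \<alpha> by (rule hrep_arcI[OF wf h a])
    have v: "tail Q \<alpha> \<in> verts Q" "head Q \<alpha> \<in> verts Q" using a by auto
    obtain x y where xy: "z = (x, y)" "x \<in> K (tail Q \<alpha>)" "y \<in> ?K' (tail Q \<alpha>)"
      using z by (auto simp: hrep_dsum_simps U_def V_def)
    have "amap T \<alpha> x \<in> K (head Q \<alpha>)" "amap T \<alpha> y \<in> ?K' (head Q \<alpha>)"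
      using K K' a xy unfolding reducing_def by blast+
    moreover have "amap T \<alpha> (x + y) = amap T \<alpha> x + amap T \<alpha> y"
      using amap_linear xy KV[OF v(1)] unfolding linear_between_def by blast
    ultimately show "C (head Q \<alpha>) (amap (hrep_dsum U V) \<alpha> z) = amap T \<alpha> (C (tail Q \<alpha>) z)"
      using v xy by (simp add: C_def hrep_dsum_simps U_def V_def)
  qed (simp add: C_def)
  moreover have "bij_betw (C i) (vspace (hrep_dsum U V) i) (vspace T i)" if i: "i \<in> verts Q" for i
  proof -
    interpret fd_inner_product "scl T" "vspace T i" "ip T i" by (rule is_hrep_space[OF h i])
    have Ci: "C i (x, y) = x + y" if "x \<in> K i" "y \<in> ?K' i" for x y
      using i that by (simp add: C_def)
    have disj: "x = 0" if "x \<in> K i" "x \<in> ?K' i" for x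
      using that KV[OF i] ip_eq_0[of x] by (auto simp: orthogonal_complement_def)
    show ?thesis
      unfolding bij_betw_def
    proof
      show "inj_on (C i) (vspace (hrep_dsum U V) i)"
      proof (rule inj_onI)
        fix z z' assume z: "z \<in> vspace (hrep_dsum U V) i" "z' \<in> vspace (hrep_dsum U V) i"
          and eq: "C i z = C i z'"
        obtain x y x' y' where xy: "z = (x, y)" "z' = (x', y')"
          "x \<in> K i" "x' \<in> K i" "y \<in> ?K' i" "y' \<in> ?K' i"
          using z by (auto simp: hrep_dsum_simps U_def V_def)
        have "x - x' = y' - y"
          using eq xy Ci by (simp add: algebra_simps)
        moreover have "x - x' \<in> K i" "y' - y \<in> ?K' i"
          using xy Ksub[OF i] by (auto intro: subspace_diff)
        ultimately have "x - x' = 0" "y' - y = 0"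
          using disj[of "x - x'"] by simp_all
        then show "z = z'" using xy by simp
      qed
      show "C i ` vspace (hrep_dsum U V) i = vspace T i"
      proof
        show "C i ` vspace (hrep_dsum U V) i \<subseteq> vspace T i"
          using KV[OF i] Ci by (auto simp: hrep_dsum_simps U_def V_def subset_iff intro!: subspace_add[OF sub])
        show "vspace T i \<subseteq> C i ` vspace (hrep_dsum U V) i"
        proof
          fix x assume "x \<in> vspace T i"
          then obtain y z where yz: "y \<in> K i" "z \<in> vspace T i" "\<forall>u\<in>K i. ip T i z u = 0" "x = y + z"
            using orthogonal_decomposition[OF Ksub(1)[OF i] KV(1)[OF i]] by blast
          then have "z \<in> ?K' i" by (simp add: orthogonal_complement_def)
          then have "x = C i (y, z)" "(y, z) \<in> vspace (hrep_dsum U V) i"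
            using yz Ci by (simp_all add: hrep_dsum_simps U_def V_def)
          then show "x \<in> C i ` vspace (hrep_dsum U V) i" by blast
        qed
      qed
    qed
  qed
  moreover have "is_rep Q T" "is_rep Q (hrep_dsum U V)"
    using h D unfolding orthoscalar_def is_hrep_def by blast+
  ultimately have "rep_equiv Q T (hrep_dsum U V)"
    using rep_equivI assms(1) by blast
  then show "osrep_equiv Q W B T (hrep_dsum U V)"
    by (rule rep_equiv_imp_osrep_equiv[OF assms(1) sep T D])
qed

section \<open>Indecomposable orthoscalar representations are bricks\<close>

text \<open>Otherwise \<open>K\<close> and its complement would be two nonzero orthoscalar summands.
  The complement therefore vanishes at every vertex, even though \<open>K\<close> is only assumed
  nonzero at some vertex.\<close>

lemma indecomposable_os_reducing:
  assumes "fin_digraph Q" "separated Q W B" and ind: "indecomposable_Rep_os Q W B T"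
    and K: "reducing Q T K" and nz: "\<exists>i\<in>verts Q. K i \<noteq> {0}" and i: "i \<in> verts Q"
  shows "K i = vspace T i"
proof -
  obtain \<chi> where T: "orthoscalar Q W B \<chi> T"
    using ind unfolding indecomposable_Rep_os_def is_osrep_def by blast
  let ?U = "T\<lparr>vspace := K\<rparr>" and ?V = "T\<lparr>vspace := orthogonal_complement T K\<rparr>"
  note dec = reducing_decomposition[OF assms(1,2) T K]
  have "nonzero_rep Q ?U" using nz unfolding nonzero_rep_def by simp
  then have "\<not> nonzero_rep Q ?V"
    using ind dec unfolding indecomposable_Rep_os_def is_osrep_def by blast
  then have perp: "orthogonal_complement T K i = {0}"
    using i unfolding nonzero_rep_def by auto
  have h: "is_hrep Q T" using T unfolding orthoscalar_def by blast
  interpret fd_inner_product "scl T" "vspace T i" "ip T i" by (rule is_hrep_space[OF h i])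
  have KV: "subspace (K i)" "K i \<subseteq> vspace T i" using K i unfolding reducing_def by blast+
  have "x \<in> K i" if x: "x \<in> vspace T i" for x
  proof -
    obtain y z where yz: "y \<in> K i" "z \<in> vspace T i" "\<forall>u\<in>K i. ip T i z u = 0" "x = y + z"
      using orthogonal_decomposition[OF KV x] by blast
    then have "z = 0" using perp unfolding orthogonal_complement_def by blast
    then show ?thesis using yz by simp
  qed
  then show ?thesis using KV by blast
qed

lemma indecomposable_os_endomorphism:
  assumes "fin_digraph Q" "separated Q W B" and ind: "indecomposable_Rep_os Q W B T"
    and C: "C \<in> RepHom Q T T"
  shows "\<exists>c. \<forall>i\<in>verts Q. \<forall>x\<in>vspace T i. C i x = scl T c x"
proof -
  interpret fin_digraph Q by fact
  have wf: "wf_digraph Q" by unfold_locales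
  obtain \<chi> where T: "orthoscalar Q W B \<chi> T"
    using ind unfolding indecomposable_Rep_os_def is_osrep_def by blast
  have h: "is_hrep Q T" using T unfolding orthoscalar_def by blast
  have vs: "vector_space (scl T)" using h unfolding is_hrep_def is_rep_def by blast
  interpret complex_vector_space "scl T" by (simp add: complex_vector_space_def vs)
  have CH: "C \<in> HRepHom Q T T"
    by (rule RepHom_orthoscalar[OF assms(1,2) T T C])
  note Clin = RepHom_linear[OF C]
  have findim: "findim_subspace (scl T) (vspace T i)" if "i \<in> verts Q" for i
    using h that unfolding is_hrep_def is_rep_def by blast
  then have sub: "subspace (vspace T i)" if "i \<in> verts Q" for i
    using that unfolding findim_subspace_def by blast
  obtain k where k: "k \<in> verts Q" "vspace T k \<noteq> {0}"
    using ind unfolding indecomposable_Rep_os_def nonzero_rep_def by blast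
  obtain c x where cx: "x \<in> vspace T k" "x \<noteq> 0" "C k x = scl T c x"
    using exists_eigenvector[OF vs findim[OF k(1)] k(2) Clin[OF k(1)]] by blast
  \<comment> \<open>The scalar \<open>c\<close> found at the vertex \<open>k\<close> is used at
    every vertex. Elsewhere \<open>K i\<close> could a priori be zero; being nonzero at
    \<open>k\<close> is enough for the preceding lemma.\<close>
  define K where "K i = {x \<in> vspace T i. C i x = scl T c x}" for i
  have "reducing Q T K"
    unfolding reducing_def
  proof (intro conjI ballI)
    fix i assume i: "i \<in> verts Q"
    show "subspace (K i)"
      unfolding subspace_def K_def using Clin[OF i] sub[OF i] linear_between_0[OF Clin[OF i] sub[OF i] vs]
      by (auto simp: linear_between_def scale_right_distrib mult.commute
          subspace_0 subspace_add subspace_scale)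
    show "K i \<subseteq> vspace T i" unfolding K_def by blast
  next
    fix \<alpha> assume a: "\<alpha> \<in> arcs Q"
    interpret hrep_arc Q T \<alpha> by (rule hrep_arcI[OF wf h a])
    {
      fix x assume "x \<in> K (tail Q \<alpha>)"
      then show "amap T \<alpha> x \<in> K (head Q \<alpha>)"
        using amap_linear RepHom_commute[OF C a] by (auto simp: K_def linear_between_def)
    next
      fix y assume "y \<in> K (head Q \<alpha>)"
      \<comment> \<open>Orthoscalarity enters here, through the membership of \<open>C\<close> in
        \<open>HRepHom\<close>.\<close>
      moreover have "\<forall>y\<in>vspace T (head Q \<alpha>). C (tail Q \<alpha>) (adj Q T \<alpha> y) = adj Q T \<alpha> (C (head Q \<alpha>) y)"
        using CH a unfolding HRepHom_def by blast
      ultimately show "adj Q T \<alpha> y \<in> K (tail Q \<alpha>)"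
        using adj_linear by (auto simp: K_def linear_between_def)
    }
  qed
  moreover have "\<exists>i\<in>verts Q. K i \<noteq> {0}"
    using k(1) cx unfolding K_def by blast
  ultimately have "K i = vspace T i" if "i \<in> verts Q" for i
    using indecomposable_os_reducing[OF assms(1,2) ind] that by blast
  then show ?thesis unfolding K_def by blast
qed

section \<open>Consequences of having only scalar endomorphisms\<close>

text \<open>A decomposition would transport the projection \<open>p\<close> onto the first summand
  to an endomorphism \<open>P\<close> of \<open>T\<close>. No single scalar can act as the identity
  on one nonzero summand and as zero on the other.\<close>

lemma scalar_endomorphisms_imp_indecomposable:
  fixes T :: "('v, 'e, 'a::ab_group_add, 'm) rep_scheme"
  assumes T: "is_rep Q T" and nz: "nonzero_rep Q T" and "wf_digraph Q"
    and sc: "\<And>C. C \<in> RepHom Q T T \<Longrightarrow> \<exists>c. \<forall>i\<in>verts Q. \<forall>x\<in>vspace T i. C i x = scl T c x"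
  shows "indecomposable_Rep Q T"
  unfolding indecomposable_Rep_def
proof (intro conjI T nz notI, elim exE conjE)
  fix U V :: "('v, 'e, 'a) rep"
  assume U: "is_rep Q U" "nonzero_rep Q U" and V: "is_rep Q V" "nonzero_rep Q V"
    and eq: "rep_equiv Q T (rep_dsum U V)"
  interpret wf_digraph Q by fact
  let ?S = "rep_dsum U V"
  obtain C D where C: "C \<in> RepHom Q T ?S" and D: "D \<in> RepHom Q ?S T"
    and id: "comp_mor Q ?S C D = id_mor Q ?S"
    using eq unfolding rep_equiv_def by blast
  have S: "is_rep Q ?S" using eq unfolding rep_equiv_def by blast
  have vs: "vector_space (scl T)" "vector_space (scl U)" "vector_space (scl V)" "vector_space (scl ?S)"
    using T U V S unfolding is_rep_def by blast+
  interpret T: complex_vector_space "scl T" by (simp add: complex_vector_space_def vs)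
  interpret S: complex_vector_space "scl ?S" by (simp add: complex_vector_space_def vs)
  interpret V: complex_vector_space "scl V" by (simp add: complex_vector_space_def vs)
  have subT: "T.subspace (vspace T i)" and subS: "S.subspace (vspace ?S i)"
    and subU: "module.subspace (scl U) (vspace U i)" and subV: "V.subspace (vspace V i)"
    if "i \<in> verts Q" for i
    using T S U V that unfolding is_rep_def findim_subspace_def by blast+
  have U0: "0 \<in> vspace U i" if "i \<in> verts Q" for i
    using subU[OF that] module.subspace_0 vs(2) module_iff_vector_space by blast
  have V0: "0 \<in> vspace V i" if "i \<in> verts Q" for i
    using V.subspace_0[OF subV[OF that]] .
  have vS: "vspace ?S i = vspace U i \<times> vspace V i" for i by (simp add: rep_dsum_def)
  have CD: "C i (D i z) = z" if "i \<in> verts Q" "z \<in> vspace ?S i" for i z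
    using fun_cong[OF fun_cong[OF id, of i], of z] that by (simp add: comp_mor_def id_mor_def)
  note Dlin = RepHom_linear[OF D] and Clin = RepHom_linear[OF C]
  note Din = linear_between_in[OF Dlin] and Cin = linear_between_in[OF Clin]
  define p where "p z = (fst z, 0 :: 'a)" for z :: "'a \<times> 'a"
  have p_in: "p z \<in> vspace ?S i" if "i \<in> verts Q" "z \<in> vspace ?S i" for i z
    using that V0 by (auto simp: vS p_def)
  define P where "P = (\<lambda>i\<in>verts Q. \<lambda>x\<in>vspace T i. D i (p (C i x)))"
  have "P \<in> RepHom Q T T"
    unfolding RepHom_def
  proof (intro CollectI conjI ballI)
    fix i assume i: "i \<in> verts Q"
    show "P i \<in> extensional (vspace T i)" using i by (simp add: P_def)
    have "linear_between (scl ?S) (vspace ?S i) (scl ?S) (vspace ?S i) p"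
      using p_in[OF i] by (auto simp: linear_between_def p_def rep_dsum_def)
    from linear_between_comp[OF linear_between_comp[OF Clin[OF i] this] Dlin[OF i]]
    show "linear_between (scl T) (vspace T i) (scl T) (vspace T i) (P i)"
      using i T.subspace_add[OF subT[OF i]] T.subspace_scale[OF subT[OF i]]
      by (simp add: linear_between_def P_def)
  next
    fix \<alpha> x assume a: "\<alpha> \<in> arcs Q" and x: "x \<in> vspace T (tail Q \<alpha>)"
    have v: "tail Q \<alpha> \<in> verts Q" "head Q \<alpha> \<in> verts Q" using a by auto
    have Vlin: "linear_between (scl V) (vspace V (tail Q \<alpha>)) (scl V) (vspace V (head Q \<alpha>)) (amap V \<alpha>)"
      by (rule is_rep_amap[OF V(1) a])
    \<comment> \<open>In the second component this says that \<open>amap V \<alpha>\<close> sends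
      zero to zero.\<close>
    have "p (amap ?S \<alpha> z) = amap ?S \<alpha> (p z)" for z
      using V.linear_between_0[OF Vlin subV[OF v(1)] vs(3)]
      by (simp add: p_def rep_dsum_def split_beta)
    then show "P (head Q \<alpha>) (amap T \<alpha> x) = amap T \<alpha> (P (tail Q \<alpha>) x)"
      using v x linear_between_in[OF is_rep_amap[OF T a] x] Cin[OF v(1) x]
        RepHom_commute[OF C a x] RepHom_commute[OF D a p_in[OF v(1) Cin[OF v(1) x]]]
      by (simp add: P_def)
  qed (simp add: P_def)
  then obtain c where c: "\<And>i x. i \<in> verts Q \<Longrightarrow> x \<in> vspace T i \<Longrightarrow> P i x = scl T c x"
    using sc by blast
  have PD: "P i (D i z) = D i (p z)" if "i \<in> verts Q" "z \<in> vspace ?S i" for i z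
    using that Din CD by (simp add: P_def)
  have D0: "D i 0 = 0" if "i \<in> verts Q" for i
    by (rule S.linear_between_0[OF Dlin[OF that] subS[OF that] vs(1)])
  have C0: "C i 0 = 0" if "i \<in> verts Q" for i
    by (rule T.linear_between_0[OF Clin[OF that] subT[OF that] vs(4)])
  have Dnz: "D i z \<noteq> 0" if "i \<in> verts Q" "z \<in> vspace ?S i" "z \<noteq> 0" for i z
    using CD[OF that(1,2)] C0 that by metis
  obtain i where i: "i \<in> verts Q" "vspace U i \<noteq> {0}"
    using U(2) unfolding nonzero_rep_def by blast
  then obtain x where x: "x \<in> vspace U i" "x \<noteq> 0" using U0 by blast
  have z: "(x, 0) \<in> vspace ?S i" using x V0[OF i(1)] by (simp add: vS)
  have "scl T c (D i (x, 0)) = D i (x, 0)"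
    using c[OF i(1) Din[OF i(1) z]] PD[OF i(1) z] by (simp add: p_def)
  then have "scl T c (D i (x, 0)) = scl T 1 (D i (x, 0))" by simp
  then have "c = 1"
    using Dnz[OF i(1) z] x(2) T.scale_right_imp_eq by (metis Pair_inject zero_prod_def)
  obtain j where j: "j \<in> verts Q" "vspace V j \<noteq> {0}"
    using V(2) unfolding nonzero_rep_def by blast
  then obtain y where y: "y \<in> vspace V j" "y \<noteq> 0" using V0 by blast
  \<comment> \<open>The vertex \<open>j\<close> may differ from \<open>i\<close>, but the scalar is
    common to all vertices: \<open>P\<close> kills the second summand and yet is now the
    identity.\<close>
  have z': "(0, y) \<in> vspace ?S j" using y U0[OF j(1)] by (simp add: vS)
  have "D j (0, y) = 0"
    using c[OF j(1) Din[OF j(1) z']] PD[OF j(1) z'] D0[OF j(1)] \<open>c = 1\<close>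
    by (simp add: p_def zero_prod_def)
  then show False
    using Dnz[OF j(1) z'] y(2) by (metis Pair_inject zero_prod_def)
qed

text \<open>The map \<open>m\<close> sending a scalar to its multiple of the identity is onto by
  hypothesis and one-to-one because a nonzero vector exists. Its inverse \<open>h\<close> has the
  direction required of the ring isomorphism.\<close>

lemma scalar_endomorphisms_imp_schurian:
  assumes T: "is_rep Q T" and nz: "nonzero_rep Q T" and "wf_digraph Q"
    and sc: "\<And>C. C \<in> RepHom Q T T \<Longrightarrow> \<exists>c. \<forall>i\<in>verts Q. \<forall>x\<in>vspace T i. C i x = scl T c x"
  shows "schurian_Rep Q T"
proof -
  interpret wf_digraph Q by fact
  interpret complex_vector_space "scl T"
    using T by (simp add: is_rep_def complex_vector_space_def)
  have sub: "subspace (vspace T i)" if "i \<in> verts Q" for i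
    using T that unfolding is_rep_def findim_subspace_def by blast
  define m where "m c = (\<lambda>i\<in>verts Q. \<lambda>x\<in>vspace T i. scl T c x)" for c
  have m_in: "m c \<in> RepHom Q T T" for c
    unfolding RepHom_def
  proof (intro CollectI conjI ballI)
    fix i assume i: "i \<in> verts Q"
    then show "linear_between (scl T) (vspace T i) (scl T) (vspace T i) (m c i)"
      by (simp add: m_def linear_between_def subspace_add subspace_scale sub scale_right_distrib
          mult.commute)
    show "m c i \<in> extensional (vspace T i)" using i by (simp add: m_def)
  next
    fix \<alpha> x assume a: "\<alpha> \<in> arcs Q" "x \<in> vspace T (tail Q \<alpha>)"
    then show "m c (head Q \<alpha>) (amap T \<alpha> x) = amap T \<alpha> (m c (tail Q \<alpha>) x)"
      using is_rep_amap[OF T a(1)] by (simp add: m_def linear_between_def)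
  qed (simp add: m_def)
  have "C \<in> range m" if C: "C \<in> RepHom Q T T" for C
  proof -
    obtain c where "\<And>i x. i \<in> verts Q \<Longrightarrow> x \<in> vspace T i \<Longrightarrow> C i x = scl T c x"
      using sc[OF C] by blast
    moreover have "C \<in> extensional (verts Q)" "\<And>i. i \<in> verts Q \<Longrightarrow> C i \<in> extensional (vspace T i)"
      using C unfolding RepHom_def by blast+
    \<comment> \<open>Extensionality turns agreement on the spaces into equality of
      functions.\<close>
    ultimately have "C = m c"
      by (auto simp: m_def fun_eq_iff restrict_def extensional_def)
    then show ?thesis by blast
  qed
  then have range: "range m = RepHom Q T T" using m_in by blast
  obtain k where k: "k \<in> verts Q" "vspace T k \<noteq> {0}"
    using nz unfolding nonzero_rep_def by blast
  then obtain x where x: "x \<in> vspace T k" "x \<noteq> 0" using subspace_0[OF sub] by blast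
  have "inj m"
  proof (rule injI)
    fix a b assume "m a = m b"
    then have "m a k x = m b k x" by simp
    then show "a = b" using k(1) x by (simp add: m_def)
  qed
  define h where "h = the_inv m"
  have hm: "h (m c) = c" for c
    unfolding h_def using \<open>inj m\<close> by (rule the_inv_f_f)
  have bij: "bij_betw h (RepHom Q T T) UNIV"
    unfolding h_def using \<open>inj m\<close> range by (intro bij_betw_the_inv_into) (simp add: bij_betw_def)
  have mult: "comp_mor Q T (m a) (m b) = m (a * b)" for a b
    by (auto simp: comp_mor_def m_def fun_eq_iff restrict_def subspace_scale sub)
  have add: "(\<lambda>i\<in>verts Q. \<lambda>x\<in>vspace T i. m a i x + m b i x) = m (a + b)" for a b
    by (auto simp: m_def fun_eq_iff restrict_def scale_left_distrib)
  have one: "id_mor Q T = m 1"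
    by (auto simp: id_mor_def m_def fun_eq_iff restrict_def)
  have "h \<in> ring_iso (End_ring Q T) (ring_of_type_algebra :: complex ring)"
    unfolding ring_iso_def ring_hom_def
    using bij by (auto simp: End_ring_def ring_of_type_algebra_def range[symmetric] hm mult add one)
  then show ?thesis
    using T unfolding schurian_Rep_def is_ring_iso_def by blast
qed

theorem theorem1:
  fixes Q :: "('v, 'e) pre_digraph" and W B :: "'v set"
  assumes "fin_digraph Q" and "nomulti_digraph Q" and "separated Q W B"
  shows
    "(\<forall>\<chi> (T :: ('v, 'e, 'a::ab_group_add) hrep) (T' :: ('v, 'e, 'b::ab_group_add) hrep).
        orthoscalar Q W B \<chi> T \<and> orthoscalar Q W B \<chi> T' \<and> rep_equiv Q T T' \<longrightarrow>
        osrep_equiv Q W B T T') \<and>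
     (\<forall>T :: ('v, 'e, 'a) hrep.
        indecomposable_Rep_os Q W B T \<longrightarrow> indecomposable_Rep Q T \<and> schurian_Rep Q T)"
proof (intro conjI allI impI)
  fix \<chi> and T :: "('v, 'e, 'a) hrep" and T' :: "('v, 'e, 'b) hrep"
  assume "orthoscalar Q W B \<chi> T \<and> orthoscalar Q W B \<chi> T' \<and> rep_equiv Q T T'"
  then show "osrep_equiv Q W B T T'"
    using rep_equiv_imp_osrep_equiv[OF assms(1,3)] by blast
next
  fix T :: "('v, 'e, 'a) hrep"
  assume ind: "indecomposable_Rep_os Q W B T"
  interpret fin_digraph Q by fact
  have wf: "wf_digraph Q" by unfold_locales
  have T: "is_rep Q T" "nonzero_rep Q T"
    using ind unfolding indecomposable_Rep_os_def is_osrep_def orthoscalar_def is_hrep_def by blast+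
  note sc = indecomposable_os_endomorphism[OF assms(1,3) ind]
  show "indecomposable_Rep Q T"
    by (rule scalar_endomorphisms_imp_indecomposable[OF T wf sc])
  show "schurian_Rep Q T"
    by (rule scalar_endomorphisms_imp_schurian[OF T wf sc])
qed

end
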